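(* Consider a sub-Gaussian multi-armed bandit with $K$ arms. Let $0<\delta<1$ and let EXP3.P be run with $\gamma=2\sqrt{\frac{3K\ln K}{5T}}$ and $\alpha=2\sqrt{\ln\frac{KT}{\delta}}$. Then there is a function $h(T)=O^*(\sqrt T)$ such that $$R'_T\le E[R_T]\le h(T).$$
   Context: Multi-armed bandit (MAB): $K$ arms, horizon $T$. At each step $t=1,\dots,T$ there is a reward vector $r^t=(r^t_1,\dots,r^t_K)$; the player pulls an arm $i_t$ and receives (and observes only) $y_t=r^t_{i_t}$. Regret: $R_T=\max_{1\le j\le K}\sum_{t=1}^Tr^t_j-\sum_{t=1}^Ty_t$. Pseudo regret: $R'_T=T\cdot\max_k\mu_k-\sum_{t=1}^TE[y_t]$. Sub-Gaussian MAB: the reward vectors $r^1,\dots,r^T$ are i.i.d. with density $f$ on $\mathbb R^K$, mean vector $\mu=(\mu_1,\dots,\mu_K)$ and covariance matrix $\Sigma=(a_{ij})$, non-degenerate in the sense $\min_ja_{jj}>0$, with sub-Gaussian coordinates. A random variable $X$ is $\sigma^2$-sub-Gaussian if $P(|X|>s)\le Be^{-\sigma^2s^2}$ for every $s>0$, with $B$ a positive constant. Algorithm EXP3.P with parameters $\alpha>0$, $\gamma\in(0,1)$: initialize $w_i(1)=\exp\left(\frac{\alpha\gamma}{3}\sqrt{\frac TK}\right)$, $i=1,\dots,K$. For $t=1,\dots,T$: set $p_i(t)=(1-\gamma)\frac{w_i(t)}{\sum_{j=1}^Kw_j(t)}+\frac\gamma K$; draw $i_t$ from $(p_1(t),\dots,p_K(t))$;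 receive $r^t_{i_t}$; for each $j$ set $\hat x_j(t)=\frac{r^t_j}{p_j(t)}\mathbf 1_{j=i_t}$ and $w_j(t+1)=w_j(t)\exp\left(\frac{\gamma}{3K}\left(\hat x_j(t)+\frac{\alpha}{p_j(t)\sqrt{KT}}\right)\right)$. Notation: $h(T)=O^*(g(T))$ means $h(T)=O(g(T)\log^k g(T))$ as $T\to\infty$ for some integer $k$. *)

theory Defs
  imports "HOL-Probability.Probability" "HOL-Library.Landau_Symbols"
begin

text \<open>
  The arms are the elements of a finite type, so the number of arms is its cardinality, and reward
  vectors live in the Euclidean space indexed by that type. Rounds are numbered
  from 0 to T - 1, so round t here is step t + 1 in the usual numbering from 1 to T.
\<close>

definition sub_gaussian :: "'a measure \<Rightarrow> real \<Rightarrow> ('a \<Rightarrow> real) \<Rightarrow> bool" where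
  "sub_gaussian M \<sigma> X \<longleftrightarrow>
     X \<in> borel_measurable M \<and>
     (\<exists>B>0. \<forall>s>0. measure M {x \<in> space M. \<bar>X x\<bar> > s} \<le> B * exp (- (\<sigma>\<^sup>2 * s\<^sup>2)))"

definition reward_law :: "(real^'k \<Rightarrow> real) \<Rightarrow> (real^'k) measure" where
  "reward_law f = density lborel (\<lambda>x. ennreal (f x))"

definition mean_vector :: "(real^'k \<Rightarrow> real) \<Rightarrow> real^'k" where
  "mean_vector f = (\<chi> j. \<integral>x. x $ j \<partial>reward_law f)"

definition covariance_matrix :: "(real^'k \<Rightarrow> real) \<Rightarrow> real^'k^'k" where
  "covariance_matrix f =
     (\<chi> i j. \<integral>x. (x $ i - mean_vector f $ i) * (x $ j - mean_vector f $ j) \<partial>reward_law f)"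

definition sub_gaussian_bandit :: "(real^'k \<Rightarrow> real) \<Rightarrow> bool" where
  "sub_gaussian_bandit f \<longleftrightarrow>
     f \<in> borel_measurable borel \<and> (\<forall>x. 0 \<le> f x) \<and> prob_space (reward_law f) \<and>
     0 < (MIN j. covariance_matrix f $ j $ j) \<and>
     (\<forall>j. \<exists>\<sigma>>0. sub_gaussian (reward_law f) \<sigma> (\<lambda>x. x $ j))"

definition exp3p_prob :: "real \<Rightarrow> ('k \<Rightarrow> real) \<Rightarrow> 'k::finite \<Rightarrow> real" where
  "exp3p_prob \<gamma> w j = (1 - \<gamma>) * (w j / (\<Sum>i\<in>UNIV. w i)) + \<gamma> / CARD('k)"

definition exp3p_estimate :: "real \<Rightarrow> ('k \<Rightarrow> real) \<Rightarrow> 'k \<Rightarrow> real^'k \<Rightarrow> 'k::finite \<Rightarrow> real" where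
  "exp3p_estimate \<gamma> w i x j = (x $ j / exp3p_prob \<gamma> w j) * of_bool (j = i)"

text \<open>
  \<open>exp3p_weights \<alpha> \<gamma> T i x t\<close> are the weights at the beginning of round \<open>t\<close>, when the arms
  \<open>i 0, \<dots>, i (t - 1)\<close> were pulled and the reward vectors were \<open>x 0, \<dots>, x (t - 1)\<close>; they depend on
  \<open>x s\<close> only through the received reward \<open>x s $ i s\<close>.
\<close>

primrec exp3p_weights ::
    "real \<Rightarrow> real \<Rightarrow> nat \<Rightarrow> (nat \<Rightarrow> 'k) \<Rightarrow> (nat \<Rightarrow> real^'k) \<Rightarrow> nat \<Rightarrow> 'k::finite \<Rightarrow> real" where
  "exp3p_weights \<alpha> \<gamma> T i x 0 = (\<lambda>j. exp (\<alpha> * \<gamma> / 3 * sqrt (T / CARD('k))))"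
| "exp3p_weights \<alpha> \<gamma> T i x (Suc t) =
     (let w = exp3p_weights \<alpha> \<gamma> T i x t in
      (\<lambda>j. w j * exp (\<gamma> / (3 * CARD('k)) *
        (exp3p_estimate \<gamma> w (i t) (x t) j
         + \<alpha> / (exp3p_prob \<gamma> w j * sqrt (CARD('k) * T))))))"

text \<open>
  The information relative to which the arm of round \<open>t\<close> is drawn: the earlier arms and the
  reward vectors of all rounds. Later rewards are included because the draw uses fresh
  randomness of the player, independent of the environment; independence of the reward vectors
  among themselves would not exclude that an arm is correlated with a later reward.
\<close>

definition draw_history ::
    "'w measure \<Rightarrow> nat \<Rightarrow> (nat \<Rightarrow> 'w \<Rightarrow> real^'k) \<Rightarrow> (nat \<Rightarrow> 'w \<Rightarrow> 'k) \<Rightarrow> nat \<Rightarrow> 'w measure" where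
  "draw_history M T r I t =
     vimage_algebra (space M) (\<lambda>\<omega>. (\<lambda>s\<in>{..<T}. r s \<omega>, \<lambda>s\<in>{..<t}. I s \<omega>))
       (Pi\<^sub>M {..<T} (\<lambda>_. borel) \<Otimes>\<^sub>M Pi\<^sub>M {..<t} (\<lambda>_. count_space UNIV))"

text \<open>
  On the probability space \<open>M\<close>, the reward vectors \<open>r 0, \<dots>, r (T - 1)\<close> are i.i.d. with density
  \<open>f\<close>, and \<open>I 0, \<dots>, I (T - 1)\<close> are the arms pulled by EXP3.P.
\<close>

definition exp3p_run ::
    "(real^'k \<Rightarrow> real) \<Rightarrow> real \<Rightarrow> real \<Rightarrow> nat \<Rightarrow> 'w measure \<Rightarrow>
     (nat \<Rightarrow> 'w \<Rightarrow> real^'k) \<Rightarrow> (nat \<Rightarrow> 'w \<Rightarrow> 'k::finite) \<Rightarrow> bool" where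
  "exp3p_run f \<alpha> \<gamma> T M r I \<longleftrightarrow>
     0 < \<alpha> \<and> 0 < \<gamma> \<and> \<gamma> < 1 \<and>
     prob_space M \<and>
     (\<forall>t<T. distributed M lborel (r t) (\<lambda>x. ennreal (f x))) \<and>
     prob_space.indep_vars M (\<lambda>_. borel) r {..<T} \<and>
     (\<forall>t<T. I t \<in> measurable M (count_space UNIV)) \<and>
     (\<forall>t<T. \<forall>j. AE \<omega> in M.
        real_cond_exp M (draw_history M T r I t) (indicator {\<omega>' \<in> space M. I t \<omega>' = j}) \<omega>
          = exp3p_prob \<gamma> (exp3p_weights \<alpha> \<gamma> T (\<lambda>s. I s \<omega>) (\<lambda>s. r s \<omega>) t) j)"

definition regret ::
    "nat \<Rightarrow> (nat \<Rightarrow> 'w \<Rightarrow> real^'k) \<Rightarrow> (nat \<Rightarrow> 'w \<Rightarrow> 'k::finite) \<Rightarrow> 'w \<Rightarrow> real" where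
  "regret T r I \<omega> = (MAX j. \<Sum>t<T. r t \<omega> $ j) - (\<Sum>t<T. r t \<omega> $ I t \<omega>)"

definition pseudo_regret ::
    "(real^'k \<Rightarrow> real) \<Rightarrow> 'w measure \<Rightarrow> nat \<Rightarrow> (nat \<Rightarrow> 'w \<Rightarrow> real^'k) \<Rightarrow>
     (nat \<Rightarrow> 'w \<Rightarrow> 'k::finite) \<Rightarrow> real" where
  "pseudo_regret f M T r I =
     real T * (MAX k. mean_vector f $ k) - (\<Sum>t<T. \<integral>\<omega>. r t \<omega> $ I t \<omega> \<partial>M)"

definition bigo_star :: "(nat \<Rightarrow> real) \<Rightarrow> (nat \<Rightarrow> real) \<Rightarrow> bool" where
  "bigo_star h g \<longleftrightarrow> (\<exists>k::int. h \<in> O(\<lambda>T. g T * ln (g T) powi k))"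

end

theory Submission
  imports Defs "HOL-Real_Asymp.Real_Asymp"
begin

text \<open>
  Since the rewards are i.i.d., the whole regret can be estimated in expectation, without any
  high-probability bound. By Bienayme's identity the best cumulative reward exceeds \<open>T max \<mu>\<close> by only
  \<open>O(sqrt T)\<close> on average, so it remains to bound the pseudo regret. For this one follows \<open>ln W\<close>, the
  logarithm of the total weight. Pathwise, \<open>ln W\<close> is at least the exponent of any single arm, and it
  grows per round by at most the relative increase of \<open>W\<close>. The arm of a round is drawn with the known
  conditional probability and the reward vector is independent of the past, so the expectations of
  both sides are explicit up to second-order terms. The rewards are not bounded, but exploration
  gives \<open>p \<ge> \<gamma> / K\<close>, so the second-order terms are controlled by \<open>E (x\<^sup>2 exp (\<bar>x\<bar> / 3))\<close>, which is
  finite for a sub-Gaussian \<open>x\<close>. For the finitely many \<open>T\<close> at which \<open>\<gamma>\<close> or the confidence bonus is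
  too large, a bound linear in \<open>T\<close> suffices.
\<close>

section \<open>Exponential moments of sub-Gaussian variables\<close>

text \<open>Taylor's formula with Lagrange remainder. Since rewards are unbounded, no smallness of
  \<open>z\<close> is available; the factor \<open>exp \<bar>z\<bar>\<close> pays for that.\<close>

lemma exp_le_quadratic: "exp z \<le> 1 + z + z\<^sup>2 * exp \<bar>z\<bar>" for z :: real
proof -
  obtain t where t: "\<bar>t\<bar> \<le> \<bar>z\<bar>" "exp z = (\<Sum>m<2. z ^ m / fact m) + exp t / fact 2 * z ^ 2"
    using Maclaurin_exp_le[of z 2] by blast
  have "exp t / 2 \<le> exp \<bar>z\<bar>"
    using t(1) by (smt (verit) exp_le_cancel_iff exp_gt_zero field_sum_of_halves)
  then have "exp t / 2 * z\<^sup>2 \<le> exp \<bar>z\<bar> * z\<^sup>2"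
    by (intro mult_right_mono) auto
  then show ?thesis
    using t(2) by (simp add: numeral_2_eq_2 mult.commute)
qed

text \<open>Cutting at integer levels bounds \<open>exp \<bar>X x\<bar>\<close> by \<open>1\<close>
  plus the sum of \<open>exp (n + 1)\<close> over all \<open>n\<close> with
  \<open>\<bar>X x\<bar> > n\<close>. The Gaussian tails beat these exponential factors.\<close>

lemma integrable_exp_sub_gaussian:
  assumes N: "prob_space N" and "sub_gaussian N \<sigma> X" and "0 < \<sigma>"
  shows "integrable N (\<lambda>x. exp \<bar>X x\<bar>)"
proof -
  interpret prob_space N by fact
  have meas [measurable]: "X \<in> borel_measurable N"
    using assms(2) by (simp add: sub_gaussian_def)
  obtain B where B: "0 < B"
    "\<And>s. 0 < s \<Longrightarrow> prob {x \<in> space N. \<bar>X x\<bar> > s} \<le> B * exp (- (\<sigma>\<^sup>2 * s\<^sup>2))"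
    using assms(2) by (auto simp: sub_gaussian_def)
  define A where "A n = {x \<in> space N. \<bar>X x\<bar> > real n}" for n :: nat
  have A [measurable]: "A n \<in> sets N" for n unfolding A_def by measurable
  \<comment> \<open>The constant \<open>B + 1\<close> also covers \<open>n = 0\<close>, where the
    tail estimate says nothing and a probability is at most 1.\<close>
  have bound: "exp (real n + 1) * prob (A n) \<le> exp (real n + 1) * ((B + 1) * exp (- (\<sigma>\<^sup>2 * (real n)\<^sup>2)))" for n
  proof (cases "n = 0")
    case False
    then have "prob (A n) \<le> B * exp (- (\<sigma>\<^sup>2 * (real n)\<^sup>2))"
      unfolding A_def by (intro B) auto
    also have "\<dots> \<le> (B + 1) * exp (- (\<sigma>\<^sup>2 * (real n)\<^sup>2))"
      by (intro mult_right_mono) auto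
    finally show ?thesis by (intro mult_left_mono) auto
  next
    case True
    have "prob (A 0) \<le> 1 + B" using B(1) by (smt (verit) prob_le_1)
    with True show ?thesis by simp
  qed
  \<comment> \<open>From this \<open>n\<close> on the tail exponent is at least
    \<open>2 * n\<close>, so a geometric series with ratio \<open>exp (- 1)\<close>
    dominates.\<close>
  have "eventually (\<lambda>n. 2 / \<sigma>\<^sup>2 \<le> real n) sequentially"
    using filterlim_real_sequentially unfolding filterlim_at_top by blast
  then have "eventually (\<lambda>n. norm (exp (real n + 1) * ((B + 1) * exp (- (\<sigma>\<^sup>2 * (real n)\<^sup>2))))
      \<le> exp 1 * (B + 1) * exp (- 1) ^ n) sequentially"
  proof (rule eventually_mono)
    fix n assume "2 / \<sigma>\<^sup>2 \<le> real n"
    then have "2 \<le> \<sigma>\<^sup>2 * real n" using \<open>0 < \<sigma>\<close> by (simp add: field_simps)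
    then have "2 * real n \<le> \<sigma>\<^sup>2 * real n * real n" by (intro mult_right_mono) auto
    then have "exp (real n + 1 + - (\<sigma>\<^sup>2 * (real n)\<^sup>2)) \<le> exp (1 + real n * (- 1))"
      by (simp add: power2_eq_square mult.assoc)
    then have "(B + 1) * (exp (real n + 1) * exp (- (\<sigma>\<^sup>2 * (real n)\<^sup>2))) \<le> (B + 1) * (exp 1 * exp (- 1) ^ n)"
      using B(1) by (intro mult_left_mono) (auto simp: exp_add [symmetric] exp_of_nat_mult [symmetric])
    then show "norm (exp (real n + 1) * ((B + 1) * exp (- (\<sigma>\<^sup>2 * (real n)\<^sup>2))))
        \<le> exp 1 * (B + 1) * exp (- 1) ^ n"
      using B(1) by (simp add: abs_mult mult_ac)
  qed
  moreover have "summable (\<lambda>n. exp 1 * (B + 1) * exp (- 1 :: real) ^ n)"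
    by (intro summable_mult summable_geometric) auto
  ultimately have "summable (\<lambda>n. exp (real n + 1) * ((B + 1) * exp (- (\<sigma>\<^sup>2 * (real n)\<^sup>2))))"
    by (rule summable_comparison_test_ev)
  then have summ: "summable (\<lambda>n. exp (real n + 1) * prob (A n))"
    by (rule summable_comparison_test'[where N = 0]) (use bound in \<open>auto simp: abs_mult\<close>)
  have pointwise: "ennreal (exp \<bar>X x\<bar>) \<le> 1 + (\<Sum>n. ennreal (exp (real n + 1)) * indicator (A n) x)"
    if x: "x \<in> space N" for x
  proof (cases "X x = 0")
    case False
    \<comment> \<open>The largest level strictly below \<open>\<bar>X x\<bar>\<close>. The case
      \<open>X x = 0\<close> exceeds no level and is covered by the summand
      \<open>1\<close>.\<close>
    define n where "n = nat (\<lceil>\<bar>X x\<bar>\<rceil> - 1)"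
    have n: "real n < \<bar>X x\<bar>" "\<bar>X x\<bar> \<le> real n + 1"
      using False unfolding n_def by linarith+
    define F where "F m = ennreal (exp (real m + 1)) * indicator (A m) x" for m
    have "ennreal (exp \<bar>X x\<bar>) \<le> F n"
      using n x by (simp add: A_def F_def)
    also have "\<dots> = (\<Sum>m\<in>{n}. F m)" by simp
    also have "\<dots> \<le> (\<Sum>m. F m)"
      by (intro sum_le_suminf) auto
    also have "\<dots> \<le> 1 + (\<Sum>m. F m)"
      by simp
    finally show ?thesis unfolding F_def .
  qed simp
  have "(\<integral>\<^sup>+ x. ennreal (exp \<bar>X x\<bar>) \<partial>N)
      \<le> (\<integral>\<^sup>+ x. 1 + (\<Sum>n. ennreal (exp (real n + 1)) * indicator (A n) x) \<partial>N)"
    by (intro nn_integral_mono pointwise)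
  also have "\<dots> = 1 + (\<Sum>n. ennreal (exp (real n + 1)) * emeasure N (A n))"
    by (simp add: nn_integral_add nn_integral_suminf nn_integral_cmult_indicator emeasure_space_1)
  also have "\<dots> = 1 + (\<Sum>n. ennreal (exp (real n + 1) * prob (A n)))"
    by (simp add: emeasure_eq_measure ennreal_mult)
  also have "\<dots> < \<infinity>"
    using summ by (simp add: suminf_ennreal2 ennreal_add_eq_top less_top)
  finally show ?thesis
    by (intro integrableI_bounded) auto
qed

text \<open>The Taylor polynomial of \<open>exp (2 * \<bar>x\<bar> / 3)\<close> contains
  \<open>2 * x\<^sup>2 / 9\<close>, and 9/2 is at most 5. The exponent
  \<open>\<bar>x\<bar> / 3\<close> is the one that exploration guarantees.\<close>

lemma square_exp_third_le: "x\<^sup>2 * exp (\<bar>x\<bar> / 3) \<le> 5 * exp \<bar>x\<bar>" for x :: real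
proof -
  have "1 + 2 * \<bar>x\<bar> / 3 + (2 * \<bar>x\<bar> / 3)\<^sup>2 / 2 \<le> exp (2 * \<bar>x\<bar> / 3)"
    by (intro exp_lower_Taylor_quadratic) auto
  then have "1 + 2 * \<bar>x\<bar> / 3 + 2 * x\<^sup>2 / 9 \<le> exp (2 * \<bar>x\<bar> / 3)"
    by (simp add: power_mult_distrib power_divide)
  then have "x\<^sup>2 \<le> 5 * exp (2 * \<bar>x\<bar> / 3)"
    using exp_gt_zero[of "2 * \<bar>x\<bar> / 3"] abs_ge_zero[of x] by linarith
  then have "x\<^sup>2 * exp (\<bar>x\<bar> / 3) \<le> 5 * exp (2 * \<bar>x\<bar> / 3) * exp (\<bar>x\<bar> / 3)"
    by (intro mult_right_mono) auto
  also have "\<dots> = 5 * exp \<bar>x\<bar>"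
    by (simp add: exp_add [symmetric])
  finally show ?thesis .
qed

lemma square_le_exp: "x\<^sup>2 \<le> 5 * exp \<bar>x\<bar>" for x :: real
proof -
  have "x\<^sup>2 * 1 \<le> x\<^sup>2 * exp (\<bar>x\<bar> / 3)"
    by (intro mult_left_mono) auto
  then show ?thesis using square_exp_third_le[of x] by linarith
qed

section \<open>Pathwise analysis of the potential\<close>

text \<open>The distribution \<open>q\<close> that the weights alone would prescribe, before it is
  mixed with uniform exploration.\<close>

definition sample_weight :: "('k \<Rightarrow> real) \<Rightarrow> 'k::finite \<Rightarrow> real" where
  "sample_weight w j = w j / (\<Sum>i\<in>UNIV. w i)"

lemma sample_weight_bounds:
  fixes w :: "'k::finite \<Rightarrow> real"
  assumes "\<And>j. 0 < w j"
  shows "0 < sample_weight w j" "sample_weight w j \<le> 1" "(\<Sum>j\<in>UNIV. sample_weight w j) = 1"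
proof -
  have pos: "0 < (\<Sum>i\<in>UNIV. w i)" by (intro sum_pos) (auto simp: assms)
  show "0 < sample_weight w j" using assms pos by (simp add: sample_weight_def)
  have "w j \<le> (\<Sum>i\<in>UNIV. w i)" by (intro member_le_sum) (auto intro: less_imp_le assms)
  then show "sample_weight w j \<le> 1" using pos by (simp add: sample_weight_def)
  show "(\<Sum>j\<in>UNIV. sample_weight w j) = 1"
    using pos by (simp add: sample_weight_def flip: sum_divide_distrib)
qed

lemma exp3p_prob_conv: "exp3p_prob \<gamma> w j = (1 - \<gamma>) * sample_weight w j + \<gamma> / CARD('k)"
  for j :: "'k::finite"
  by (simp add: exp3p_prob_def sample_weight_def)

lemma exp3p_prob_bounds:
  fixes w :: "'k::finite \<Rightarrow> real"
  assumes w: "\<And>j. 0 < w j" and "0 < \<gamma>" "\<gamma> < 1"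
  shows "\<gamma> / CARD('k) \<le> exp3p_prob \<gamma> w j" "0 < exp3p_prob \<gamma> w j" "exp3p_prob \<gamma> w j \<le> 1"
proof -
  note q = sample_weight_bounds[of w, OF w]
  show 1: "\<gamma> / CARD('k) \<le> exp3p_prob \<gamma> w j"
    using q(1)[of j] assms by (simp add: exp3p_prob_conv)
  have "0 < \<gamma> / CARD('k)" using assms by simp
  with 1 show "0 < exp3p_prob \<gamma> w j" by linarith
  have "\<gamma> / CARD('k) \<le> \<gamma> / 1" using assms
    by (intro divide_left_mono) (auto simp: Suc_le_eq)
  moreover have "(1 - \<gamma>) * sample_weight w j \<le> (1 - \<gamma>) * 1"
    using q(2)[of j] assms by (intro mult_left_mono) auto
  ultimately show "exp3p_prob \<gamma> w j \<le> 1" by (simp add: exp3p_prob_conv)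
qed

text \<open>The mixture keeps a share \<open>1 - \<gamma> \<ge> 1 / 2\<close> of the weight
  distribution.\<close>

lemma sample_weight_le_exp3p_prob:
  fixes w :: "'k::finite \<Rightarrow> real"
  assumes w: "\<And>j. 0 < w j" and "0 < \<gamma>" "\<gamma> \<le> 1 / 2"
  shows "sample_weight w j / exp3p_prob \<gamma> w j \<le> 2"
proof -
  have "(1 / 2) * sample_weight w j \<le> (1 - \<gamma>) * sample_weight w j"
    using sample_weight_bounds(1)[of w j, OF w] assms by (intro mult_right_mono) auto
  also have "\<dots> \<le> exp3p_prob \<gamma> w j" using assms by (simp add: exp3p_prob_conv)
  finally show ?thesis
    using exp3p_prob_bounds(2)[of w \<gamma> j] assms by (simp add: field_simps)
qed

text \<open>The remainder of \<open>exp_le_quadratic\<close> at \<open>z = \<eta> * x / p\<close>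
  once \<open>(\<eta> / p)\<^sup>2\<close> is taken out and the exponent is bounded by
  \<open>\<bar>x\<bar> / 3\<close>.\<close>

definition second_order :: "real \<Rightarrow> real" where
  "second_order x = x\<^sup>2 * exp (\<bar>x\<bar> / 3)"

lemma second_order_nonneg: "0 \<le> second_order x"
  by (simp add: second_order_def)

text \<open>
  The exploration rate keeps the exponent \<open>\<eta> * x / p\<close> below \<open>\<bar>x\<bar> / 3\<close>, so that all terms beyond the
  linear one are controlled by exponential moments of the reward, although it is unbounded.
\<close>

lemma exp3p_factor_le:
  fixes w :: "'k::finite \<Rightarrow> real" and \<gamma> c :: real and y :: "real^'k"
  defines "\<eta> \<equiv> \<gamma> / (3 * CARD('k))"
  assumes w: "\<And>j. 0 < w j" and \<gamma>: "0 < \<gamma>" "\<gamma> \<le> 1 / 2" and c: "0 \<le> c" "c \<le> 1"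
  shows "sample_weight w j * exp (\<eta> * (exp3p_estimate \<gamma> w i y j + c / exp3p_prob \<gamma> w j))
    \<le> sample_weight w j
      + \<eta> * (sample_weight w j * exp3p_estimate \<gamma> w i y j
        + 2 * \<eta> * (of_bool (i = j) / exp3p_prob \<gamma> w j * second_order (y $ j))
        + 4 * c * (1 + \<bar>y $ j\<bar> + second_order (y $ j)))"
proof -
  define q where "q = sample_weight w j"
  define p where "p = exp3p_prob \<gamma> w j"
  define G where "G = second_order (y $ j)"
  define o1 where "o1 = (of_bool (i = j) :: real)"
  define z where "z = \<eta> * exp3p_estimate \<gamma> w i y j"
  define u where "u = \<eta> * (c / p)"
  have K: "0 < real CARD('k)" by simp
  have \<eta>: "0 < \<eta>" using \<gamma> by (simp add: \<eta>_def)
  have q: "0 < q" "q \<le> 1" using sample_weight_bounds[of w, OF w] by (auto simp: q_def)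
  have p: "0 < p" "\<gamma> / CARD('k) \<le> p"
    using exp3p_prob_bounds[of w \<gamma> j, OF w] \<gamma> by (auto simp: p_def)
  have qp: "q / p \<le> 2"
    using sample_weight_le_exp3p_prob[of w \<gamma> j, OF w] \<gamma> by (simp add: p_def q_def)
  have \<eta>p: "\<eta> / p \<le> 1 / 3"
    using p(2) \<open>0 < p\<close> K by (simp add: \<eta>_def field_simps)
  have G: "0 \<le> G" by (simp add: G_def second_order_nonneg)
  have z_eq: "z = o1 * (\<eta> / p) * y $ j"
    by (auto simp: z_def o1_def p_def exp3p_estimate_def)
  have abs_z: "\<bar>z\<bar> \<le> \<bar>y $ j\<bar> / 3"
  proof -
    have "\<bar>z\<bar> = o1 * (\<eta> / p) * \<bar>y $ j\<bar>"
      using \<eta> p by (simp add: z_eq abs_mult o1_def)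
    also have "\<dots> \<le> (1 * (1 / 3)) * \<bar>y $ j\<bar>"
      using \<eta>p \<eta> p by (intro mult_right_mono mult_mono) (auto simp: o1_def)
    finally show ?thesis by simp
  qed
  have z2: "z\<^sup>2 * exp \<bar>z\<bar> \<le> o1 * (\<eta> / p)\<^sup>2 * G"
  proof -
    have "z\<^sup>2 * exp \<bar>z\<bar> \<le> z\<^sup>2 * exp (\<bar>y $ j\<bar> / 3)"
      using abs_z by (intro mult_left_mono) auto
    also have "\<dots> = o1 * (\<eta> / p)\<^sup>2 * G"
      by (simp add: z_eq G_def second_order_def power_mult_distrib power_divide o1_def)
    finally show ?thesis .
  qed
  have u: "0 \<le> u" "u \<le> 1"
  proof -
    show "0 \<le> u" using \<eta> c p by (simp add: u_def)
    have "u = \<eta> / p * c" by (simp add: u_def)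
    also have "\<dots> \<le> 1 / 3 * 1" using \<eta>p c by (intro mult_mono) auto
    finally show "u \<le> 1" by simp
  qed
  have exp_z: "exp z \<le> 1 + z + o1 * (\<eta> / p)\<^sup>2 * G"
    using exp_le_quadratic[of z] z2 by linarith
  \<comment> \<open>A crude bound on \<open>exp z\<close> is enough here: it only multiplies
    \<open>u\<close>, which already carries the small factor \<open>c\<close>.\<close>
  have "o1 * (\<eta> / p)\<^sup>2 * G \<le> 1 * 1 * G"
  proof -
    have "(\<eta> / p)\<^sup>2 \<le> 1" using \<eta>p \<eta> p by (intro power_le_one) auto
    then show ?thesis using G by (intro mult_right_mono mult_mono) (auto simp: o1_def)
  qed
  with exp_z abs_z have exp_z': "exp z \<le> 1 + \<bar>y $ j\<bar> + G" by linarith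
  have "exp u \<le> 1 + 2 * u"
  proof -
    have "exp u \<le> 1 + u + u\<^sup>2" using u by (intro exp_bound) auto
    moreover have "u\<^sup>2 \<le> u" using u by (simp add: power2_eq_square mult_left_le)
    ultimately show ?thesis by linarith
  qed
  then have "exp z * exp u \<le> exp z * (1 + 2 * u)"
    by (intro mult_left_mono) auto
  also have "\<dots> = exp z + 2 * u * exp z" by (simp add: algebra_simps)
  also have "\<dots> \<le> (1 + z + o1 * (\<eta> / p)\<^sup>2 * G) + 2 * u * (1 + \<bar>y $ j\<bar> + G)"
    using exp_z exp_z' u by (intro add_mono mult_left_mono) auto
  finally have "q * (exp z * exp u) \<le> q * ((1 + z + o1 * (\<eta> / p)\<^sup>2 * G) + 2 * u * (1 + \<bar>y $ j\<bar> + G))"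
    using q by (intro mult_left_mono) auto
  also have "\<dots> = q + q * z + q / p * (\<eta>\<^sup>2 * (o1 / p) * G) + q / p * (2 * \<eta> * c * (1 + \<bar>y $ j\<bar> + G))"
    using p by (simp add: u_def power2_eq_square field_simps)
  \<comment> \<open>The factor \<open>q / p\<close> absorbs one power of \<open>1 / p\<close>. In
    the second-order term the other power stays next to the indicator of the drawn arm and will
    cancel in expectation.\<close>
  also have "\<dots> \<le> q + q * z + 2 * (\<eta>\<^sup>2 * (o1 / p) * G) + 2 * (2 * \<eta> * c * (1 + \<bar>y $ j\<bar> + G))"
    using qp G c \<eta> p by (intro add_mono mult_right_mono order_refl) (auto simp: o1_def)
  finally have "q * exp (z + u) \<le> q + q * z + 2 * (\<eta>\<^sup>2 * (o1 / p) * G) + 2 * (2 * \<eta> * c * (1 + \<bar>y $ j\<bar> + G))"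
    by (simp add: exp_add)
  then show ?thesis
    unfolding q_def[symmetric] p_def[symmetric] G_def[symmetric] o1_def[symmetric]
    by (simp add: z_def u_def algebra_simps power2_eq_square)
qed

lemma exp3p_weights_pos: "0 < exp3p_weights \<alpha> \<gamma> T i x t j"
  by (induction t arbitrary: j) (auto simp: Let_def)

text \<open>A deterministic inequality for arbitrary arms and rewards. \<open>ln (W n)\<close> is
  bounded above by telescoping with \<open>ln y \<le> y - 1\<close> and
  \<open>exp3p_factor_le\<close>, and below by the weight of arm \<open>k\<close> alone.\<close>

lemma exp3p_potential:
  fixes i :: "nat \<Rightarrow> 'k::finite" and x :: "nat \<Rightarrow> real^'k" and \<alpha> \<gamma> :: real and T :: nat
  defines "\<eta> \<equiv> \<gamma> / (3 * CARD('k))" and "c \<equiv> \<alpha> / sqrt (CARD('k) * T)"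
  defines "w \<equiv> exp3p_weights \<alpha> \<gamma> T i x"
  assumes \<gamma>: "0 < \<gamma>" "\<gamma> \<le> 1 / 2" and c: "0 \<le> c" "c \<le> 1"
  shows "(\<Sum>t<n. exp3p_estimate \<gamma> (w t) (i t) (x t) k)
    \<le> ln CARD('k) / \<eta>
      + (\<Sum>t<n. \<Sum>j\<in>UNIV. sample_weight (w t) j * exp3p_estimate \<gamma> (w t) (i t) (x t) j
        + 2 * \<eta> * (of_bool (i t = j) / exp3p_prob \<gamma> (w t) j * second_order (x t $ j))
        + 4 * c * (1 + \<bar>x t $ j\<bar> + second_order (x t $ j)))"
proof -
  define W where "W t = (\<Sum>j\<in>UNIV. w t j)" for t
  define R where "R t j = sample_weight (w t) j * exp3p_estimate \<gamma> (w t) (i t) (x t) j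
        + 2 * \<eta> * (of_bool (i t = j) / exp3p_prob \<gamma> (w t) j * second_order (x t $ j))
        + 4 * c * (1 + \<bar>x t $ j\<bar> + second_order (x t $ j))" for t j
  have w_pos: "0 < w t j" for t j by (simp add: w_def exp3p_weights_pos)
  have W_pos: "0 < W t" for t unfolding W_def by (intro sum_pos) (auto simp: w_pos)
  have \<eta>: "0 < \<eta>" using \<gamma> by (simp add: \<eta>_def)
  have w_Suc: "w (Suc t) j = w t j * exp (\<eta> * (exp3p_estimate \<gamma> (w t) (i t) (x t) j + c / exp3p_prob \<gamma> (w t) j))" for t j
    by (simp add: w_def Let_def \<eta>_def c_def mult.commute)
  have upper: "ln (W m) \<le> ln (W 0) + \<eta> * (\<Sum>t<m. \<Sum>j\<in>UNIV. R t j)" for m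
  proof (induction m)
    case (Suc m)
    have "W (Suc m) / W m = (\<Sum>j\<in>UNIV. sample_weight (w m) j * exp (\<eta> * (exp3p_estimate \<gamma> (w m) (i m) (x m) j + c / exp3p_prob \<gamma> (w m) j)))"
      unfolding W_def[of "Suc m"] by (simp add: w_Suc sample_weight_def sum_divide_distrib W_def)
    also have "\<dots> \<le> (\<Sum>j\<in>UNIV. sample_weight (w m) j + \<eta> * R m j)"
      unfolding R_def \<eta>_def by (intro sum_mono exp3p_factor_le w_pos \<gamma> c)
    also have "\<dots> = 1 + \<eta> * (\<Sum>j\<in>UNIV. R m j)"
      using sample_weight_bounds(3)[of "w m", OF w_pos] by (simp add: sum.distrib sum_distrib_left)
    finally have "W (Suc m) / W m - 1 \<le> \<eta> * (\<Sum>j\<in>UNIV. R m j)" by simp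
    moreover have "ln (W (Suc m) / W m) \<le> W (Suc m) / W m - 1"
      using W_pos by (intro ln_le_minus_one) auto
    moreover have "ln (W (Suc m) / W m) = ln (W (Suc m)) - ln (W m)"
      using W_pos[of m] W_pos[of "Suc m"] by (simp add: ln_div)
    ultimately show ?case using Suc by (simp add: algebra_simps)
  qed simp
  \<comment> \<open>The confidence bonus is nonnegative and is dropped on this side.\<close>
  have lower: "ln (w 0 k) + \<eta> * (\<Sum>t<m. exp3p_estimate \<gamma> (w t) (i t) (x t) k) \<le> ln (w m k)" for m
  proof (induction m)
    case (Suc m)
    have "0 \<le> \<eta> * (c / exp3p_prob \<gamma> (w m) k)"
      using \<eta> c exp3p_prob_bounds(2)[of "w m" \<gamma> k, OF w_pos] \<gamma> by (simp add: less_imp_le)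
    then show ?case using Suc w_pos[of m k]
      by (simp add: w_Suc ln_mult algebra_simps)
  qed simp
  have "w n k \<le> W n"
    unfolding W_def by (intro member_le_sum) (auto intro: less_imp_le w_pos)
  then have "ln (w n k) \<le> ln (W n)"
    using w_pos[of n k] W_pos[of n] by simp
  \<comment> \<open>The initial weights are all equal, so their common value cancels and only the
    logarithm of the number of arms remains.\<close>
  moreover have "ln (W 0) = ln CARD('k) + ln (w 0 k)"
    by (simp add: W_def w_def ln_mult)
  ultimately have "\<eta> * (\<Sum>t<n. exp3p_estimate \<gamma> (w t) (i t) (x t) k)
      \<le> ln CARD('k) + \<eta> * (\<Sum>t<n. \<Sum>j\<in>UNIV. R t j)"
    using upper[of n] lower[of n] by linarith
  then show ?thesis
    unfolding R_def[symmetric] using \<eta> by (simp add: field_simps)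
qed

section \<open>Independence and measurability\<close>

text \<open>Bienayme's identity for centred variables: a new variable is independent of the sum of
  the others, so the mixed term has mean zero.\<close>

lemma (in prob_space) expectation_indep_sum_square:
  fixes X :: "'i \<Rightarrow> 'a \<Rightarrow> real"
  assumes "finite J" "indep_vars (\<lambda>_. borel) X J"
    and "\<And>i. i \<in> J \<Longrightarrow> integrable M (\<lambda>\<omega>. (X i \<omega>)\<^sup>2)"
    and "\<And>i. i \<in> J \<Longrightarrow> expectation (X i) = 0"
  shows "integrable M (\<lambda>\<omega>. (\<Sum>i\<in>J. X i \<omega>)\<^sup>2)
    \<and> expectation (\<lambda>\<omega>. (\<Sum>i\<in>J. X i \<omega>)\<^sup>2) = (\<Sum>i\<in>J. expectation (\<lambda>\<omega>. (X i \<omega>)\<^sup>2))"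
  using assms
proof (induction J rule: finite_induct)
  case (insert i J)
  define S where "S \<omega> = (\<Sum>i\<in>J. X i \<omega>)" for \<omega>
  have rv: "random_variable borel (X j)" if "j \<in> insert i J" for j
    using insert.prems(1) that by (auto simp: indep_vars_def)
  have IH: "integrable M (\<lambda>\<omega>. (S \<omega>)\<^sup>2)"
    "expectation (\<lambda>\<omega>. (S \<omega>)\<^sup>2) = (\<Sum>i\<in>J. expectation (\<lambda>\<omega>. (X i \<omega>)\<^sup>2))"
    using insert.IH[OF indep_vars_subset[OF insert.prems(1)]] insert.prems by (auto simp: S_def)
  have ind: "indep_var borel (X i) borel S"
    unfolding S_def using insert.hyps insert.prems(1) by (rule indep_vars_sum)
  have int_X: "integrable M (X j)" if "j \<in> insert i J" for j
    using square_integrable_imp_integrable[OF rv[OF that] insert.prems(2)[OF that]] .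
  have int_S: "integrable M S" unfolding S_def by (intro Bochner_Integration.integrable_sum int_X) auto
  have int_X2: "integrable M (\<lambda>\<omega>. (X i \<omega>)\<^sup>2)" using insert.prems by simp
  have int_XS: "integrable M (\<lambda>\<omega>. X i \<omega> * S \<omega>)"
    using ind int_X int_S by (intro indep_var_integrable) auto
  have XS: "expectation (\<lambda>\<omega>. X i \<omega> * S \<omega>) = 0"
    using ind int_X int_S insert.prems(3)[of i] by (subst indep_var_lebesgue_integral) auto
  have eq: "(\<Sum>j\<in>insert i J. X j \<omega>)\<^sup>2 = (X i \<omega>)\<^sup>2 + 2 * (X i \<omega> * S \<omega>) + (S \<omega>)\<^sup>2" for \<omega>
    using insert.hyps by (simp add: S_def power2_sum)
  have "integrable M (\<lambda>\<omega>. (X i \<omega>)\<^sup>2 + 2 * (X i \<omega> * S \<omega>) + (S \<omega>)\<^sup>2)"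
    using int_X2 int_XS IH(1) by (intro Bochner_Integration.integrable_add integrable_mult_right)
  moreover have "expectation (\<lambda>\<omega>. (X i \<omega>)\<^sup>2 + 2 * (X i \<omega> * S \<omega>) + (S \<omega>)\<^sup>2)
      = expectation (\<lambda>\<omega>. (X i \<omega>)\<^sup>2) + expectation (\<lambda>\<omega>. (S \<omega>)\<^sup>2)"
    using int_X2 int_XS IH(1) XS by simp
  ultimately show ?case
    unfolding eq using insert.hyps IH(2) by simp
qed simp

text \<open>Passes from events to random variables. In the applications \<open>F\<close> is a
  history and \<open>Y\<close> a reward vector, for which only a product formula on events can be
  proved by induction directly.\<close>

lemma (in prob_space) indep_var_subalgebra:
  assumes F: "subalgebra M F" and X: "X \<in> measurable F S" and Y: "Y \<in> measurable M N"
    and g: "g \<in> measurable N S'"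
    and indep: "\<And>A B. A \<in> sets F \<Longrightarrow> B \<in> sets N \<Longrightarrow>
      prob (A \<inter> (Y -` B \<inter> space M)) = prob A * prob (Y -` B \<inter> space M)"
  shows "indep_var S X S' (\<lambda>\<omega>. g (Y \<omega>))"
proof -
  have space: "space F = space M" using F by (simp add: subalgebra_def)
  have XM: "X \<in> measurable M S" by (rule measurable_from_subalg[OF F X])
  have gY: "(\<lambda>\<omega>. g (Y \<omega>)) \<in> measurable M S'" using Y g by (rule measurable_compose)
  \<comment> \<open>Intersection stability extends the product formula from preimages to the
    sigma-algebras they generate.\<close>
  have stable: "Int_stable {Z -` A \<inter> space M |A. A \<in> sets L}" for Z :: "'a \<Rightarrow> 'z" and L
  proof (rule Int_stableI, safe)
    fix A B assume "A \<in> sets L" "B \<in> sets L"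
    then show "\<exists>C. Z -` A \<inter> space M \<inter> (Z -` B \<inter> space M) = Z -` C \<inter> space M \<and> C \<in> sets L"
      by (intro exI[of _ "A \<inter> B"]) auto
  qed
  show ?thesis
    unfolding indep_var_eq
  proof (intro conjI indep_set_sigma_sets stable XM gY)
    show "indep_set {X -` A \<inter> space M |A. A \<in> sets S} {(\<lambda>\<omega>. g (Y \<omega>)) -` A \<inter> space M |A. A \<in> sets S'}"
    proof (rule indep_setI)
      show "{X -` A \<inter> space M |A. A \<in> sets S} \<subseteq> events"
        "{(\<lambda>\<omega>. g (Y \<omega>)) -` A \<inter> space M |A. A \<in> sets S'} \<subseteq> events"
        using XM gY by (auto intro: measurable_sets)
    next
      fix a b assume "a \<in> {X -` A \<inter> space M |A. A \<in> sets S}"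
        "b \<in> {(\<lambda>\<omega>. g (Y \<omega>)) -` A \<inter> space M |A. A \<in> sets S'}"
      then obtain A B where A: "a = X -` A \<inter> space M" "A \<in> sets S"
        and B: "b = (\<lambda>\<omega>. g (Y \<omega>)) -` B \<inter> space M" "B \<in> sets S'"
        by blast
      have "a \<in> sets F" using measurable_sets[OF X A(2)] by (simp add: A(1) space)
      moreover have "g -` B \<inter> space N \<in> sets N" using g B(2) by (rule measurable_sets)
      moreover have "b = Y -` (g -` B \<inter> space N) \<inter> space M"
        unfolding B(1) using measurable_space[OF Y] by auto
      ultimately show "prob (a \<inter> b) = prob a * prob b" using indep by metis
    qed
  qed
qed

lemma borel_measurable_vec_component [measurable]:
  "(\<lambda>x :: real^'k. x $ j) \<in> borel_measurable borel"
  by (intro borel_measurable_continuous_onI continuous_intros)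

lemma borel_measurable_exp3p_prob:
  assumes "\<And>j. (\<lambda>\<omega>. w \<omega> j) \<in> borel_measurable N"
  shows "(\<lambda>\<omega>. exp3p_prob \<gamma> (w \<omega>) j) \<in> borel_measurable N"
proof -
  note assms [measurable]
  show ?thesis unfolding exp3p_prob_def by measurable
qed

text \<open>Only rounds before \<open>t\<close> enter the weights of round \<open>t\<close>;
  \<open>N\<close> is left open so that it can be a history.\<close>

lemma borel_measurable_exp3p_weights:
  fixes r :: "nat \<Rightarrow> 'w \<Rightarrow> real^'k::finite"
  assumes "\<And>s. s < t \<Longrightarrow> r s \<in> borel_measurable N"
    and "\<And>s. s < t \<Longrightarrow> I s \<in> measurable N (count_space UNIV)"
  shows "(\<lambda>\<omega>. exp3p_weights \<alpha> \<gamma> T (\<lambda>s. I s \<omega>) (\<lambda>s. r s \<omega>) t j) \<in> borel_measurable N"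
  using assms
proof (induction t arbitrary: j)
  case (Suc t)
  have w [measurable]: "(\<lambda>\<omega>. exp3p_weights \<alpha> \<gamma> T (\<lambda>s. I s \<omega>) (\<lambda>s. r s \<omega>) t j) \<in> borel_measurable N" for j
    using Suc by simp
  have p [measurable]: "(\<lambda>\<omega>. exp3p_prob \<gamma> (exp3p_weights \<alpha> \<gamma> T (\<lambda>s. I s \<omega>) (\<lambda>s. r s \<omega>) t) j) \<in> borel_measurable N" for j
    by (intro borel_measurable_exp3p_prob w)
  have [measurable]: "r t \<in> borel_measurable N" "I t \<in> measurable N (count_space UNIV)"
    using Suc.prems by auto
  have [measurable]: "(\<lambda>\<omega>. exp3p_estimate \<gamma> (exp3p_weights \<alpha> \<gamma> T (\<lambda>s. I s \<omega>) (\<lambda>s. r s \<omega>) t) (I t \<omega>) (r t \<omega>) j) \<in> borel_measurable N"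
    unfolding exp3p_estimate_def of_bool_def by measurable
  show ?case by (simp add: Let_def) measurable
qed simp

lemma space_draw_history [simp]: "space (draw_history M n r I t) = space M"
  by (simp add: draw_history_def)

text \<open>With \<open>N = M\<close> this places a history inside the whole space; with a longer
  history as \<open>N\<close> it gives monotonicity.\<close>

lemma subalgebra_draw_history:
  assumes [simp]: "space N = space M"
    and "\<And>s. s < n \<Longrightarrow> r s \<in> borel_measurable N"
    and "\<And>s. s < t \<Longrightarrow> I s \<in> measurable N (count_space UNIV)"
  shows "subalgebra N (draw_history M n r I t)"
proof -
  let ?H = "\<lambda>\<omega>. (\<lambda>s\<in>{..<n}. r s \<omega>, \<lambda>s\<in>{..<t}. I s \<omega>)"
  have "?H \<in> measurable N (Pi\<^sub>M {..<n} (\<lambda>_. borel) \<Otimes>\<^sub>M Pi\<^sub>M {..<t} (\<lambda>_. count_space UNIV))"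
    using assms by (intro measurable_Pair measurable_restrict) auto
  then have "sets (draw_history M n r I t) \<subseteq> sets N"
    by (simp add: measurable_iff_sets draw_history_def)
  then show ?thesis by (simp add: subalgebra_def)
qed

lemma draw_history_measurable:
  fixes r :: "nat \<Rightarrow> 'w \<Rightarrow> real^'k::finite"
  shows "s < n \<Longrightarrow> r s \<in> borel_measurable (draw_history M n r I t)"
    and "s < t \<Longrightarrow> I s \<in> measurable (draw_history M n r I t) (count_space UNIV)"
proof -
  let ?H = "\<lambda>\<omega>. (\<lambda>s\<in>{..<n}. r s \<omega>, \<lambda>s\<in>{..<t}. I s \<omega>)"
  have H: "?H \<in> measurable (draw_history M n r I t)
      (Pi\<^sub>M {..<n} (\<lambda>_. borel) \<Otimes>\<^sub>M Pi\<^sub>M {..<t} (\<lambda>_. count_space UNIV))"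
    unfolding draw_history_def
    by (intro measurable_vimage_algebra1) (auto simp: space_pair_measure space_PiM)
  show "r s \<in> borel_measurable (draw_history M n r I t)" if "s < n"
  proof -
    have "(\<lambda>\<omega>. fst (?H \<omega>) s) \<in> borel_measurable (draw_history M n r I t)"
      using that by (intro measurable_compose[OF measurable_compose[OF H measurable_fst]]
        measurable_component_singleton) auto
    then show ?thesis using that by simp
  qed
  show "I s \<in> measurable (draw_history M n r I t) (count_space UNIV)" if "s < t"
  proof -
    have "(\<lambda>\<omega>. snd (?H \<omega>) s) \<in> measurable (draw_history M n r I t) (count_space UNIV)"
      using that by (intro measurable_compose[OF measurable_compose[OF H measurable_snd]]
        measurable_component_singleton) auto
    then show ?thesis using that by simp
  qed
qed

text \<open>Once the value \<open>j\<close> of the last arm is fixed, the longer history is a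
  function of the shorter one. This is the decomposition behind the induction in
  \<open>prob_history_reward\<close>.\<close>

lemma draw_history_Suc_cases:
  fixes r :: "nat \<Rightarrow> 'w \<Rightarrow> real^'k::finite"
  assumes "A \<in> sets (draw_history M n r I (Suc s))"
  obtains A' where "\<And>j. A' j \<in> sets (draw_history M n r I s)"
    and "A = (\<Union>j. A' j \<inter> {\<omega> \<in> space M. I s \<omega> = j})"
proof -
  let ?P = "\<lambda>s. Pi\<^sub>M {..<n} (\<lambda>_. borel :: (real^'k) measure) \<Otimes>\<^sub>M Pi\<^sub>M {..<s} (\<lambda>_. count_space (UNIV :: 'k set))"
  let ?H = "\<lambda>s \<omega>. (\<lambda>u\<in>{..<n}. r u \<omega>, \<lambda>u\<in>{..<s}. I u \<omega>)"
  have "?H (Suc s) \<in> space M \<rightarrow> space (?P (Suc s))"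
    by (auto simp: space_pair_measure space_PiM)
  then obtain S where S: "S \<in> sets (?P (Suc s))" "A = ?H (Suc s) -` S \<inter> space M"
    using assms unfolding draw_history_def by (auto simp: sets_vimage_algebra2)
  \<comment> \<open>The longer history with its last arm replaced by the constant \<open>j\<close>;
    it agrees with the true one where \<open>I s \<omega> = j\<close>.\<close>
  define H' where "H' j \<omega> = (\<lambda>u\<in>{..<n}. r u \<omega>, \<lambda>u\<in>{..<Suc s}. if u = s then j else I u \<omega>)" for j \<omega>
  have H': "H' j \<in> measurable (draw_history M n r I s) (?P (Suc s))" for j
  proof -
    have "(\<lambda>\<omega>. if u = s then j else I u \<omega>) \<in> measurable (draw_history M n r I s) (count_space UNIV)"
      if "u < Suc s" for u
      using that by (cases "u = s") (auto intro: draw_history_measurable)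
    then show ?thesis
      unfolding H'_def by (intro measurable_Pair measurable_restrict draw_history_measurable) auto
  qed
  show thesis
  proof
    show "H' j -` S \<inter> space M \<in> sets (draw_history M n r I s)" for j
      using measurable_sets[OF H' S(1)] by simp
    have "H' (I s \<omega>) \<omega> = ?H (Suc s) \<omega>" for \<omega>
      by (auto simp: H'_def fun_eq_iff)
    then show "A = (\<Union>j. (H' j -` S \<inter> space M) \<inter> {\<omega> \<in> space M. I s \<omega> = j})"
      unfolding S(2) by auto
  qed
qed

section \<open>Expectations along a run of EXP3.P\<close>

locale exp3p_bandit =
  fixes f :: "real^'k::finite \<Rightarrow> real" and \<alpha> \<gamma> :: real and T :: nat and M :: "'w measure"
    and r :: "nat \<Rightarrow> 'w \<Rightarrow> real^'k" and I :: "nat \<Rightarrow> 'w \<Rightarrow> 'k"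
  assumes bandit: "sub_gaussian_bandit f" and run: "exp3p_run f \<alpha> \<gamma> T M r I"
begin

sublocale prob_space M
  using run by (simp add: exp3p_run_def)

lemma parameters: "0 < \<alpha>" "0 < \<gamma>" "\<gamma> < 1"
  using run by (auto simp: exp3p_run_def)

section \<open>The law of a reward vector and its moments\<close>

lemma reward_measurable: "t < T \<Longrightarrow> r t \<in> borel_measurable M"
  using run by (auto simp: exp3p_run_def distributed_def)

lemma arm_measurable: "t < T \<Longrightarrow> I t \<in> measurable M (count_space UNIV)"
  using run by (auto simp: exp3p_run_def)

lemma distr_reward: "t < T \<Longrightarrow> distr M borel (r t) = reward_law f"
  using run distr_cong[of M M borel lborel "r t" "r t"]
  by (auto simp: exp3p_run_def distributed_def reward_law_def)

lemma sets_reward_law [measurable_cong, simp]: "sets (reward_law f) = sets borel"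
  by (simp add: reward_law_def)

lemma expectation_reward:
  fixes g :: "real^'k \<Rightarrow> real"
  assumes "t < T" and "g \<in> borel_measurable borel"
  shows "expectation (\<lambda>\<omega>. g (r t \<omega>)) = (\<integral>x. g x \<partial>reward_law f)"
    and "integrable (reward_law f) g \<Longrightarrow> integrable M (\<lambda>\<omega>. g (r t \<omega>))"
  using assms reward_measurable[of t] distr_reward[of t]
    integral_distr[of "r t" M borel g] integrable_distr_eq[of "r t" M borel g]
  by auto

text \<open>One domination serves the first and second moments as well as
  \<open>second_order\<close>; the constant 5 is that of \<open>square_exp_third_le\<close>.\<close>

lemma integrable_reward_law_dominated:
  fixes g :: "real^'k \<Rightarrow> real"
  assumes "g \<in> borel_measurable borel" and "\<And>x. \<bar>g x\<bar> \<le> 5 * exp \<bar>x $ j\<bar>"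
  shows "integrable (reward_law f) g"
proof -
  obtain \<sigma> where "0 < \<sigma>" "sub_gaussian (reward_law f) \<sigma> (\<lambda>x. x $ j)"
    using bandit unfolding sub_gaussian_bandit_def by blast
  moreover have "prob_space (reward_law f)"
    using bandit by (simp add: sub_gaussian_bandit_def)
  ultimately have "integrable (reward_law f) (\<lambda>x. exp \<bar>x $ j\<bar>)"
    using integrable_exp_sub_gaussian by blast
  then have "integrable (reward_law f) (\<lambda>x. 5 * exp \<bar>x $ j\<bar>)" by simp
  moreover have "g \<in> borel_measurable (reward_law f)"
    using assms(1) by (simp cong: measurable_cong_sets)
  ultimately show ?thesis
    by (rule Bochner_Integration.integrable_bound) (use assms(2) in auto)
qed

lemma integrable_reward_law:
  "integrable (reward_law f) (\<lambda>x. x $ j)"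
  "integrable (reward_law f) (\<lambda>x. (x $ j - a)\<^sup>2)"
  "integrable (reward_law f) (\<lambda>x. \<bar>x $ j\<bar>)"
  "integrable (reward_law f) (\<lambda>x. second_order (x $ j))"
proof -
  have "\<bar>y\<bar> \<le> 5 * exp \<bar>y\<bar>" for y :: real
    using exp_ge_add_one_self[of "\<bar>y\<bar>"] by (smt (verit) exp_gt_zero)
  then show 1: "integrable (reward_law f) (\<lambda>x. x $ j)"
    by (intro integrable_reward_law_dominated[of _ j]) auto
  then show "integrable (reward_law f) (\<lambda>x. \<bar>x $ j\<bar>)"
    by (rule integrable_abs)
  show "integrable (reward_law f) (\<lambda>x. second_order (x $ j))"
    using square_exp_third_le by (intro integrable_reward_law_dominated[of _ j]) (auto simp: second_order_def)
  have "integrable (reward_law f) (\<lambda>x. (x $ j)\<^sup>2)"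
    using square_le_exp by (intro integrable_reward_law_dominated[of _ j]) auto
  moreover have "integrable (reward_law f) (\<lambda>x. a)" for a :: real
  proof -
    interpret L: prob_space "reward_law f" using bandit by (simp add: sub_gaussian_bandit_def)
    show ?thesis by simp
  qed
  ultimately have "integrable (reward_law f) (\<lambda>x. (x $ j)\<^sup>2 + a\<^sup>2 - 2 * (a * x $ j))"
    using 1 by (intro Bochner_Integration.integrable_add Bochner_Integration.integrable_diff integrable_mult_right)
  then show "integrable (reward_law f) (\<lambda>x. (x $ j - a)\<^sup>2)"
    by (simp add: power2_diff mult.commute mult.left_commute)
qed

lemma integral_reward_component: "(\<integral>x. x $ j \<partial>reward_law f) = mean_vector f $ j"
  by (simp add: mean_vector_def)

section \<open>Draws and rewards relative to the history\<close>

definition weight :: "nat \<Rightarrow> 'w \<Rightarrow> 'k \<Rightarrow> real" where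
  "weight t \<omega> = exp3p_weights \<alpha> \<gamma> T (\<lambda>s. I s \<omega>) (\<lambda>s. r s \<omega>) t"

definition draw_prob :: "nat \<Rightarrow> 'w \<Rightarrow> 'k \<Rightarrow> real" where
  "draw_prob t \<omega> = exp3p_prob \<gamma> (weight t \<omega>)"

lemma weight_pos: "0 < weight t \<omega> j"
  by (simp add: weight_def exp3p_weights_pos)

lemma draw_prob_bounds: "\<gamma> / CARD('k) \<le> draw_prob t \<omega> j" "0 < draw_prob t \<omega> j" "draw_prob t \<omega> j \<le> 1"
  unfolding draw_prob_def using exp3p_prob_bounds[of "weight t \<omega>" \<gamma> j] weight_pos parameters by auto

lemma subalgebra_history: "n \<le> T \<Longrightarrow> t \<le> T \<Longrightarrow> subalgebra M (draw_history M n r I t)"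
  by (intro subalgebra_draw_history reward_measurable arm_measurable) auto

text \<open>Two kinds of history occur. With all \<open>T\<close> rewards it is the one relative to
  which arms are drawn; with the first \<open>t\<close> rewards it is the past of round
  \<open>t\<close>, from which the reward of that round is independent.\<close>

lemma subalgebra_history_mono:
  "n \<le> n' \<Longrightarrow> t \<le> t' \<Longrightarrow> subalgebra (draw_history M n' r I t') (draw_history M n r I t)"
  by (intro subalgebra_draw_history draw_history_measurable) auto

lemma weight_measurable:
  "t \<le> n \<Longrightarrow> (\<lambda>\<omega>. weight t \<omega> j) \<in> borel_measurable (draw_history M n r I t)"
  unfolding weight_def by (intro borel_measurable_exp3p_weights draw_history_measurable) auto

lemma draw_prob_measurable:
  "t \<le> n \<Longrightarrow> (\<lambda>\<omega>. draw_prob t \<omega> j) \<in> borel_measurable (draw_history M n r I t)"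
  unfolding draw_prob_def by (intro borel_measurable_exp3p_prob weight_measurable)

text \<open>The defining property of conditional expectation. Here \<open>\<phi>\<close> may depend
  on the rewards of all rounds, including the current and later ones.\<close>

lemma expectation_draw:
  assumes t: "t < T" and \<phi>: "\<phi> \<in> borel_measurable (draw_history M T r I t)" "integrable M \<phi>"
  shows "integrable M (\<lambda>\<omega>. \<phi> \<omega> * of_bool (I t \<omega> = j))"
    and "expectation (\<lambda>\<omega>. \<phi> \<omega> * of_bool (I t \<omega> = j)) = expectation (\<lambda>\<omega>. \<phi> \<omega> * draw_prob t \<omega> j)"
proof -
  let ?F = "draw_history M T r I t" and ?g = "indicator {\<omega>' \<in> space M. I t \<omega>' = j} :: 'w \<Rightarrow> real"
  have sub: "subalgebra M ?F" using t by (intro subalgebra_history) auto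
  interpret finite_measure_subalgebra M ?F by unfold_locales (rule sub)
  have [measurable]: "I t \<in> measurable M (count_space UNIV)" using t by (rule arm_measurable)
  have [measurable]: "{\<omega>' \<in> space M. I t \<omega>' = j} \<in> sets M" by measurable
  have int: "integrable M (\<lambda>\<omega>. \<phi> \<omega> * ?g \<omega>)"
    using \<phi>(2) by (intro integrable_real_mult_indicator) auto
  have eq: "\<phi> \<omega> * ?g \<omega> = \<phi> \<omega> * of_bool (I t \<omega> = j)" if "\<omega> \<in> space M" for \<omega>
    using that by auto
  show "integrable M (\<lambda>\<omega>. \<phi> \<omega> * of_bool (I t \<omega> = j))"
    by (rule Bochner_Integration.integrable_cong[OF refl, THEN iffD1, OF _ int]) (rule eq)
  have "expectation (\<lambda>\<omega>. \<phi> \<omega> * of_bool (I t \<omega> = j)) = expectation (\<lambda>\<omega>. \<phi> \<omega> * ?g \<omega>)"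
    using eq by (intro Bochner_Integration.integral_cong) auto
  also have "\<dots> = expectation (\<lambda>\<omega>. \<phi> \<omega> * real_cond_exp M ?F ?g \<omega>)"
    using int \<phi>(1) by (intro real_cond_exp_intg(2)[symmetric]) auto
  also have "\<dots> = expectation (\<lambda>\<omega>. \<phi> \<omega> * draw_prob t \<omega> j)"
  proof (rule integral_cong_AE)
    have "\<phi> \<in> borel_measurable M" using \<phi>(2) by auto
    then show "(\<lambda>\<omega>. \<phi> \<omega> * real_cond_exp M ?F ?g \<omega>) \<in> borel_measurable M"
      by (intro borel_measurable_times) auto
    have "(\<lambda>\<omega>. draw_prob t \<omega> j) \<in> borel_measurable M"
      using t by (intro measurable_from_subalg[OF sub] draw_prob_measurable) auto
    then show "(\<lambda>\<omega>. \<phi> \<omega> * draw_prob t \<omega> j) \<in> borel_measurable M"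
      using \<open>\<phi> \<in> borel_measurable M\<close> by (intro borel_measurable_times)
    have "AE \<omega> in M. real_cond_exp M ?F ?g \<omega> = draw_prob t \<omega> j"
      using run t by (auto simp: exp3p_run_def draw_prob_def weight_def)
    then show "AE \<omega> in M. \<phi> \<omega> * real_cond_exp M ?F ?g \<omega> = \<phi> \<omega> * draw_prob t \<omega> j"
      by auto
  qed
  finally show "expectation (\<lambda>\<omega>. \<phi> \<omega> * of_bool (I t \<omega> = j)) = expectation (\<lambda>\<omega>. \<phi> \<omega> * draw_prob t \<omega> j)" .
qed

text \<open>Induction on the number \<open>s\<close> of recorded arms. Without arms this is
  independence of the reward vectors. A further arm is integrated out conditionally on all rewards,
  which replaces its indicator by a draw probability that is known before the draw.\<close>

lemma prob_history_reward:
  assumes "t < T" "s \<le> t" "A \<in> sets (draw_history M t r I s)" "B \<in> sets borel"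
  shows "prob (A \<inter> (r t -` B \<inter> space M)) = prob A * prob (r t -` B \<inter> space M)"
  using assms(2,3,4)
proof (induction s arbitrary: A B)
  case 0
  let ?H = "\<lambda>\<omega>. \<lambda>u\<in>{..<t}. r u \<omega>"
  have "indep_vars (\<lambda>_. borel) r {..<T}" using run by (simp add: exp3p_run_def)
  then have ind: "indep_var (PiM {..<t} (\<lambda>_. borel)) ?H (PiM {t} (\<lambda>_. borel)) (\<lambda>\<omega>. \<lambda>u\<in>{t}. r u \<omega>)"
    using assms(1) by (intro indep_var_restrict) auto
  let ?P = "Pi\<^sub>M {..<t} (\<lambda>_. borel :: (real^'k) measure) \<Otimes>\<^sub>M Pi\<^sub>M {..<0::nat} (\<lambda>_. count_space (UNIV :: 'k set))"
  have "(\<lambda>\<omega>. (?H \<omega>, \<lambda>u\<in>{..<0::nat}. I u \<omega>)) \<in> space M \<rightarrow> space ?P"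
    by (auto simp: space_pair_measure space_PiM split: if_splits)
  then obtain S where S: "S \<in> sets ?P" "A = (\<lambda>\<omega>. (?H \<omega>, \<lambda>u\<in>{..<0}. I u \<omega>)) -` S \<inter> space M"
    using 0 unfolding draw_history_def by (auto simp: sets_vimage_algebra2)
  \<comment> \<open>The record of arms is empty here; its only possible value is the function that
    is \<open>undefined\<close> everywhere.\<close>
  define S' where "S' = (\<lambda>h. (h, \<lambda>u\<in>{..<0::nat}. undefined :: 'k)) -` S \<inter> space (Pi\<^sub>M {..<t} (\<lambda>_. borel :: (real^'k) measure))"
  have "(\<lambda>h. (h, \<lambda>u\<in>{..<0::nat}. undefined :: 'k)) \<in> measurable (Pi\<^sub>M {..<t} (\<lambda>_. borel)) ?P"
    by (intro measurable_Pair measurable_ident measurable_const) (auto simp: space_PiM)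
  then have "S' \<in> sets (Pi\<^sub>M {..<t} (\<lambda>_. borel))"
    unfolding S'_def using S(1) by (rule measurable_sets)
  moreover have "A = ?H -` S' \<inter> space M"
    unfolding S(2) S'_def by (auto simp: space_PiM restrict_def split: if_splits)
  moreover define B' where "B' = (\<lambda>h. h t) -` B \<inter> space (Pi\<^sub>M {t} (\<lambda>_. borel :: (real^'k) measure))"
  have "B' \<in> sets (Pi\<^sub>M {t} (\<lambda>_. borel))"
    unfolding B'_def using 0(3) by (intro measurable_sets[OF measurable_component_singleton]) auto
  moreover have "r t -` B \<inter> space M = (\<lambda>\<omega>. \<lambda>u\<in>{t}. r u \<omega>) -` B' \<inter> space M"
    unfolding B'_def by (auto simp: space_PiM)
  moreover have "(\<lambda>\<omega>. (?H \<omega>, \<lambda>u\<in>{t}. r u \<omega>)) -` (S' \<times> B') \<inter> space M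
      = (?H -` S' \<inter> space M) \<inter> ((\<lambda>\<omega>. \<lambda>u\<in>{t}. r u \<omega>) -` B' \<inter> space M)"
    by auto
  ultimately show ?case
    using indep_varD[OF ind, of S' B'] by metis
next
  case (Suc s)
  let ?F = "draw_history M t r I s" and ?R = "r t -` B \<inter> space M"
  have s: "s < T" "s < t" using Suc.prems assms(1) by auto
  have sub: "subalgebra M ?F" using s assms(1) by (intro subalgebra_history) auto
  have subT: "subalgebra (draw_history M T r I s) ?F"
    using assms(1) by (intro subalgebra_history_mono) auto
  have R: "?R \<in> sets M" using reward_measurable[OF assms(1)] Suc.prems(3) by (rule measurable_sets)
  have RT: "?R \<in> sets (draw_history M T r I s)"
    using measurable_sets[OF draw_history_measurable(1)[OF assms(1)] Suc.prems(3)] by simp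
  obtain A' where A': "\<And>j. A' j \<in> sets ?F" "A = (\<Union>j. A' j \<inter> {\<omega> \<in> space M. I s \<omega> = j})"
    using draw_history_Suc_cases[OF Suc.prems(2)] by metis
  have A'M: "A' j \<in> sets M" for j using A'(1) sub by (auto simp: subalgebra_def)
  have A'T: "A' j \<in> sets (draw_history M T r I s)" for j
    using A'(1) subT by (auto simp: subalgebra_def)
  have J: "{\<omega> \<in> space M. I s \<omega> = j} \<in> sets M" for j
    using arm_measurable[OF s(1)] by measurable
  define D where "D j = A' j \<inter> {\<omega> \<in> space M. I s \<omega> = j}" for j
  have D: "D j \<in> sets M" for j using A'M J by (simp add: D_def sets.Int)
  have disj: "disjoint_family D" by (auto simp: disjoint_family_on_def D_def)
  \<comment> \<open>The induction hypothesis for random variables: \<open>A' j\<close> and the draw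
    probability of round \<open>s\<close> both belong to the shorter history.\<close>
  have ind: "indep_var borel (\<lambda>\<omega>. indicator (A' j) \<omega> * draw_prob s \<omega> j) borel (\<lambda>\<omega>. indicator B (r t \<omega>) :: real)" for j
  proof -
    have "(\<lambda>\<omega>. indicator (A' j) \<omega> * draw_prob s \<omega> j) \<in> borel_measurable ?F"
      using A'(1) s by (intro borel_measurable_times borel_measurable_indicator draw_prob_measurable) auto
    then show ?thesis
      using Suc.IH s Suc.prems(3) by (intro indep_var_subalgebra[OF sub _ reward_measurable[OF assms(1)]]) auto
  qed
  have int: "integrable M (\<lambda>\<omega>. indicator (A' j) \<omega> * draw_prob s \<omega> j)" for j
  proof (rule integrable_const_bound[of _ 1])
    have "norm (indicator (A' j) \<omega> * draw_prob s \<omega> j) \<le> 1" for \<omega>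
      using draw_prob_bounds(2,3)[of s \<omega> j] by (simp add: indicator_def)
    then show "AE \<omega> in M. norm (indicator (A' j) \<omega> * draw_prob s \<omega> j) \<le> 1"
      by simp
    show "(\<lambda>\<omega>. indicator (A' j) \<omega> * draw_prob s \<omega> j) \<in> borel_measurable M"
      using s A'M by (intro borel_measurable_times borel_measurable_indicator
          measurable_from_subalg[OF sub] draw_prob_measurable) auto
  qed
  \<comment> \<open>The event \<open>E\<close> may restrict the reward of the later round
    \<open>t\<close>, because draws are specified relative to all rewards.\<close>
  have draw: "prob (E \<inter> {\<omega> \<in> space M. I s \<omega> = j}) = expectation (\<lambda>\<omega>. indicator E \<omega> * draw_prob s \<omega> j)"
    if E: "E \<in> sets (draw_history M T r I s)" for E j
  proof -
    have EM: "E \<in> sets M" using E subalgebra_history[of T s] s by (auto simp: subalgebra_def)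
    have "prob (E \<inter> {\<omega> \<in> space M. I s \<omega> = j}) = expectation (indicator (E \<inter> {\<omega> \<in> space M. I s \<omega> = j}))"
      using EM J by simp
    also have "\<dots> = expectation (\<lambda>\<omega>. indicator E \<omega> * of_bool (I s \<omega> = j))"
      by (intro Bochner_Integration.integral_cong) (auto simp: indicator_def)
    also have "\<dots> = expectation (\<lambda>\<omega>. indicator E \<omega> * draw_prob s \<omega> j)"
      using E EM s(1) by (intro expectation_draw integrable_real_indicator) (auto simp: less_top[symmetric])
    finally show ?thesis .
  qed
  have "prob (D j \<inter> ?R) = prob (D j) * prob ?R" for j
  proof -
    have "prob (D j \<inter> ?R) = prob ((A' j \<inter> ?R) \<inter> {\<omega> \<in> space M. I s \<omega> = j})"
      by (simp add: D_def Int_ac)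
    also have "\<dots> = expectation (\<lambda>\<omega>. indicator (A' j \<inter> ?R) \<omega> * draw_prob s \<omega> j)"
      using A'T RT by (intro draw) auto
    also have "\<dots> = expectation (\<lambda>\<omega>. (indicator (A' j) \<omega> * draw_prob s \<omega> j) * indicator B (r t \<omega>))"
      by (intro Bochner_Integration.integral_cong) (auto simp: indicator_def)
    also have "\<dots> = expectation (\<lambda>\<omega>. indicator (A' j) \<omega> * draw_prob s \<omega> j) * expectation (\<lambda>\<omega>. indicator B (r t \<omega>))"
    proof (rule indep_var_lebesgue_integral[OF ind int])
      have "integrable M (indicator ?R :: _ \<Rightarrow> real)"
        using R by (intro integrable_real_indicator) (auto simp: less_top[symmetric])
      then show "integrable M (\<lambda>\<omega>. indicator B (r t \<omega>) :: real)"
        by (rule Bochner_Integration.integrable_cong[THEN iffD1, rotated -1]) (auto simp: indicator_def)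
    qed
    also have "expectation (\<lambda>\<omega>. indicator B (r t \<omega>)) = expectation (indicator ?R)"
      by (intro Bochner_Integration.integral_cong) (auto simp: indicator_def)
    also have "\<dots> = prob ?R" using R by simp
    also have "expectation (\<lambda>\<omega>. indicator (A' j) \<omega> * draw_prob s \<omega> j) = prob (D j)"
      unfolding D_def using A'T by (intro draw[symmetric])
    finally show ?thesis .
  qed
  moreover have "prob (A \<inter> ?R) = (\<Sum>j\<in>UNIV. prob (D j \<inter> ?R))"
  proof -
    have *: "A \<inter> ?R = (\<Union>j. D j \<inter> ?R)" unfolding A'(2) D_def by auto
    have "disjoint_family (\<lambda>j. D j \<inter> ?R)" using disj by (auto simp: disjoint_family_on_def)
    then show ?thesis unfolding * using D R by (intro finite_measure_finite_Union) auto
  qed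
  moreover have "prob A = (\<Sum>j\<in>UNIV. prob (D j))"
    unfolding A'(2) using D disj unfolding D_def by (intro finite_measure_finite_Union) auto
  ultimately show ?case by (simp add: sum_distrib_right)
qed

text \<open>Two steps: conditioning on all rewards turns the indicator of the arm into
  \<open>draw_prob\<close>, then the reward factor splits off because it is independent of the
  past.\<close>

lemma expectation_draw_reward:
  fixes g :: "real^'k \<Rightarrow> real"
  assumes t: "t < T" and \<phi>: "\<phi> \<in> borel_measurable (draw_history M t r I t)" "\<And>\<omega>. \<bar>\<phi> \<omega>\<bar> \<le> C"
    and g: "g \<in> borel_measurable borel" "integrable (reward_law f) g"
  shows "integrable M (\<lambda>\<omega>. \<phi> \<omega> * of_bool (I t \<omega> = j) * g (r t \<omega>))"
    and "expectation (\<lambda>\<omega>. \<phi> \<omega> * of_bool (I t \<omega> = j) * g (r t \<omega>))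
      = expectation (\<lambda>\<omega>. \<phi> \<omega> * draw_prob t \<omega> j) * (\<integral>x. g x \<partial>reward_law f)"
proof -
  let ?F = "draw_history M t r I t"
  have sub: "subalgebra M ?F" using t by (intro subalgebra_history) auto
  have \<phi>M: "\<phi> \<in> borel_measurable M" by (rule measurable_from_subalg[OF sub \<phi>(1)])
  have g_int: "integrable M (\<lambda>\<omega>. g (r t \<omega>))" using t g by (intro expectation_reward)
  have int: "integrable M (\<lambda>\<omega>. \<phi> \<omega> * g (r t \<omega>))"
  proof (rule Bochner_Integration.integrable_bound)
    show "integrable M (\<lambda>\<omega>. C * g (r t \<omega>))" using g_int by simp
    show "(\<lambda>\<omega>. \<phi> \<omega> * g (r t \<omega>)) \<in> borel_measurable M"
      using \<phi>M g_int by (intro borel_measurable_times) auto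
    have "\<bar>\<phi> \<omega>\<bar> * \<bar>g (r t \<omega>)\<bar> \<le> \<bar>C\<bar> * \<bar>g (r t \<omega>)\<bar>" for \<omega>
      using \<phi>(2)[of \<omega>] by (intro mult_right_mono) auto
    then show "AE \<omega> in M. norm (\<phi> \<omega> * g (r t \<omega>)) \<le> norm (C * g (r t \<omega>))"
      by (auto simp: abs_mult)
  qed
  have meas: "(\<lambda>\<omega>. \<phi> \<omega> * g (r t \<omega>)) \<in> borel_measurable (draw_history M T r I t)"
    using t \<phi>(1) by (intro borel_measurable_times measurable_from_subalg[OF subalgebra_history_mono \<phi>(1)]
        measurable_compose[OF draw_history_measurable(1) g(1)]) auto
  have swap: "\<phi> \<omega> * of_bool (I t \<omega> = j) * g (r t \<omega>) = (\<phi> \<omega> * g (r t \<omega>)) * of_bool (I t \<omega> = j)" for \<omega>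
    by simp
  show "integrable M (\<lambda>\<omega>. \<phi> \<omega> * of_bool (I t \<omega> = j) * g (r t \<omega>))"
    unfolding swap using t meas int by (rule expectation_draw)
  have \<phi>p: "(\<lambda>\<omega>. \<phi> \<omega> * draw_prob t \<omega> j) \<in> borel_measurable ?F"
    by (intro borel_measurable_times \<phi>(1) draw_prob_measurable) simp
  have ind: "indep_var borel (\<lambda>\<omega>. \<phi> \<omega> * draw_prob t \<omega> j) borel (\<lambda>\<omega>. g (r t \<omega>))"
    using prob_history_reward[OF t order_refl]
    by (intro indep_var_subalgebra[OF sub \<phi>p reward_measurable[OF t] g(1)])
  have \<phi>p_int: "integrable M (\<lambda>\<omega>. \<phi> \<omega> * draw_prob t \<omega> j)"
  proof (rule integrable_const_bound[of _ "\<bar>C\<bar>"])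
    have "\<bar>\<phi> \<omega>\<bar> * \<bar>draw_prob t \<omega> j\<bar> \<le> \<bar>C\<bar> * 1" for \<omega>
      using \<phi>(2)[of \<omega>] draw_prob_bounds[of t \<omega> j] by (intro mult_mono) auto
    then show "AE \<omega> in M. norm (\<phi> \<omega> * draw_prob t \<omega> j) \<le> \<bar>C\<bar>"
      by (auto simp: abs_mult)
  qed (rule measurable_from_subalg[OF sub \<phi>p])
  have "expectation (\<lambda>\<omega>. \<phi> \<omega> * of_bool (I t \<omega> = j) * g (r t \<omega>))
      = expectation (\<lambda>\<omega>. \<phi> \<omega> * g (r t \<omega>) * draw_prob t \<omega> j)"
    unfolding swap using t meas int by (rule expectation_draw)
  also have "\<dots> = expectation (\<lambda>\<omega>. \<phi> \<omega> * draw_prob t \<omega> j * g (r t \<omega>))"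
    by (simp add: mult_ac)
  also have "\<dots> = expectation (\<lambda>\<omega>. \<phi> \<omega> * draw_prob t \<omega> j) * expectation (\<lambda>\<omega>. g (r t \<omega>))"
    using ind \<phi>p_int g_int by (rule indep_var_lebesgue_integral)
  also have "expectation (\<lambda>\<omega>. g (r t \<omega>)) = (\<integral>x. g x \<partial>reward_law f)"
    using t g(1) by (rule expectation_reward)
  finally show "expectation (\<lambda>\<omega>. \<phi> \<omega> * of_bool (I t \<omega> = j) * g (r t \<omega>))
      = expectation (\<lambda>\<omega>. \<phi> \<omega> * draw_prob t \<omega> j) * (\<integral>x. g x \<partial>reward_law f)" .
qed

section \<open>The potential inequality in expectation\<close>

lemma draw_prob_minus_sample_weight:
  "\<bar>sample_weight (weight t \<omega>) j - draw_prob t \<omega> j\<bar> \<le> \<gamma>"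
proof -
  have q: "0 < sample_weight (weight t \<omega>) j" "sample_weight (weight t \<omega>) j \<le> 1"
    using sample_weight_bounds[of "weight t \<omega>", OF weight_pos] by auto
  have "sample_weight (weight t \<omega>) j - draw_prob t \<omega> j = \<gamma> * (sample_weight (weight t \<omega>) j - 1 / CARD('k))"
    by (simp add: draw_prob_def exp3p_prob_conv algebra_simps)
  moreover have "0 < 1 / real CARD('k)" "1 / real CARD('k) \<le> 1" by (auto simp: Suc_le_eq)
  then have "\<bar>sample_weight (weight t \<omega>) j - 1 / CARD('k)\<bar> \<le> 1" using q by linarith
  ultimately show ?thesis using parameters by (simp add: abs_mult)
qed

lemma sample_weight_measurable:
  "t \<le> n \<Longrightarrow> (\<lambda>\<omega>. sample_weight (weight t \<omega>) j) \<in> borel_measurable (draw_history M n r I t)"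
  unfolding sample_weight_def by (intro borel_measurable_divide borel_measurable_sum weight_measurable)

lemma integrable_bounded_history:
  fixes \<phi> :: "'w \<Rightarrow> real"
  assumes "t \<le> T" "\<phi> \<in> borel_measurable (draw_history M t r I t)" "\<And>\<omega>. \<bar>\<phi> \<omega>\<bar> \<le> C"
  shows "integrable M \<phi>"
proof (rule integrable_const_bound[of _ C])
  show "\<phi> \<in> borel_measurable M"
    using measurable_from_subalg[OF subalgebra_history assms(2)] assms(1) by simp
qed (use assms(3) in auto)

lemma integrable_sample_weight:
  assumes "t < T"
  shows "integrable M (\<lambda>\<omega>. sample_weight (weight t \<omega>) j)"
proof (rule integrable_bounded_history[of t _ 1])
  show "\<bar>sample_weight (weight t \<omega>) j\<bar> \<le> 1" for \<omega>
    using sample_weight_bounds(1,2)[of "weight t \<omega>" j, OF weight_pos] by simp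
qed (use assms in \<open>auto intro: sample_weight_measurable\<close>)

lemma integrable_draw_prob:
  assumes "t < T"
  shows "integrable M (\<lambda>\<omega>. draw_prob t \<omega> j)"
proof (rule integrable_bounded_history[of t _ 1])
  show "\<bar>draw_prob t \<omega> j\<bar> \<le> 1" for \<omega>
    using draw_prob_bounds(2,3)[of t \<omega> j] by simp
qed (use assms in \<open>auto intro: draw_prob_measurable\<close>)

lemma received_reward:
  assumes t: "t < T"
  shows "integrable M (\<lambda>\<omega>. r t \<omega> $ I t \<omega>)"
    and "expectation (\<lambda>\<omega>. r t \<omega> $ I t \<omega>)
      = (\<Sum>j\<in>UNIV. expectation (\<lambda>\<omega>. draw_prob t \<omega> j) * mean_vector f $ j)"
proof -
  \<comment> \<open>The factor 1 makes each summand an instance of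
    \<open>expectation_draw_reward\<close> with a constant coefficient.\<close>
  have eq: "r t \<omega> $ I t \<omega> = (\<Sum>j\<in>UNIV. 1 * of_bool (I t \<omega> = j) * r t \<omega> $ j)" for \<omega>
    by (simp add: of_bool_def if_distrib[of "\<lambda>x. x * _"] cong: if_cong)
  have *: "integrable M (\<lambda>\<omega>. 1 * of_bool (I t \<omega> = j) * r t \<omega> $ j)"
    "expectation (\<lambda>\<omega>. 1 * of_bool (I t \<omega> = j) * r t \<omega> $ j)
      = expectation (\<lambda>\<omega>. 1 * draw_prob t \<omega> j) * (\<integral>x. x $ j \<partial>reward_law f)" for j
    by (rule expectation_draw_reward[OF t, of _ 1]; simp add: integrable_reward_law)+
  show "integrable M (\<lambda>\<omega>. r t \<omega> $ I t \<omega>)"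
    unfolding eq by (intro Bochner_Integration.integrable_sum *)
  show "expectation (\<lambda>\<omega>. r t \<omega> $ I t \<omega>)
      = (\<Sum>j\<in>UNIV. expectation (\<lambda>\<omega>. draw_prob t \<omega> j) * mean_vector f $ j)"
    unfolding eq by (subst Bochner_Integration.integral_sum) (use * integral_reward_component in auto)
qed

lemma expectation_component:
  assumes "t < T"
  shows "integrable M (\<lambda>\<omega>. r t \<omega> $ j)" "expectation (\<lambda>\<omega>. r t \<omega> $ j) = mean_vector f $ j"
  using expectation_reward[OF assms, of "\<lambda>x. x $ j"] integrable_reward_law(1) integral_reward_component
  by auto

text \<open>Expectations are taken in \<open>exp3p_potential\<close>. The estimates are unbiased, so
  the left side becomes \<open>T\<close> times the mean of arm \<open>k\<close>; on the right, the
  first-order terms become the expected received reward up to an exploration cost.\<close>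

lemma exp3p_mean_bound:
  defines "\<eta> \<equiv> \<gamma> / (3 * CARD('k))" and "c \<equiv> \<alpha> / sqrt (CARD('k) * T)"
  assumes \<gamma>: "\<gamma> \<le> 1 / 2" and c: "c \<le> 1"
  shows "T * mean_vector f $ k \<le> (\<Sum>t<T. expectation (\<lambda>\<omega>. r t \<omega> $ I t \<omega>)) + ln CARD('k) / \<eta>
    + T * (\<Sum>j\<in>UNIV. \<gamma> * \<bar>mean_vector f $ j\<bar> + 2 * \<eta> * (\<integral>x. second_order (x $ j) \<partial>reward_law f)
      + 4 * c * (1 + (\<integral>x. \<bar>x $ j\<bar> \<partial>reward_law f) + (\<integral>x. second_order (x $ j) \<partial>reward_law f)))"
proof -
  let ?q = "\<lambda>t j \<omega>. sample_weight (weight t \<omega>) j" and ?p = "\<lambda>t j \<omega>. draw_prob t \<omega> j"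
  let ?\<mu> = "\<lambda>j. mean_vector f $ j" and ?G = "\<lambda>j. \<integral>x. second_order (x $ j) \<partial>reward_law f"
  let ?m = "\<lambda>j. \<integral>x. \<bar>x $ j\<bar> \<partial>reward_law f"
  \<comment> \<open>\<open>L\<close>, \<open>R1\<close> and \<open>R2\<close> are written as a
    coefficient known from the past, the indicator of the arm and a function of the reward, as
    \<open>expectation_draw_reward\<close> requires.\<close>
  define L where "L t j \<omega> = (1 / ?p t j \<omega>) * of_bool (I t \<omega> = j) * (r t \<omega> $ j)" for t j \<omega>
  define R1 where "R1 t j \<omega> = (?q t j \<omega> / ?p t j \<omega>) * of_bool (I t \<omega> = j) * (r t \<omega> $ j)" for t j \<omega>
  define R2 where "R2 t j \<omega> = (1 / ?p t j \<omega>) * of_bool (I t \<omega> = j) * second_order (r t \<omega> $ j)" for t j \<omega>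
  define R3 where "R3 t j \<omega> = 1 + \<bar>r t \<omega> $ j\<bar> + second_order (r t \<omega> $ j)" for t j \<omega>
  have c0: "0 \<le> c" using parameters by (simp add: c_def)
  have p0: "?p t j \<omega> \<noteq> 0" for t j \<omega> using draw_prob_bounds(2)[of t \<omega> j] by simp
  have path: "(\<Sum>t<T. L t k \<omega>) \<le> ln CARD('k) / \<eta>
      + (\<Sum>t<T. \<Sum>j\<in>UNIV. R1 t j \<omega> + 2 * \<eta> * R2 t j \<omega> + 4 * c * R3 t j \<omega>)" for \<omega>
  proof -
    have est: "exp3p_estimate \<gamma> (weight t \<omega>) (I t \<omega>) (r t \<omega>) j = L t j \<omega>" for t j
      by (auto simp: exp3p_estimate_def L_def draw_prob_def)
    have R1: "?q t j \<omega> * L t j \<omega> = R1 t j \<omega>" for t j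
      by (simp add: L_def R1_def)
    have R2: "of_bool (I t \<omega> = j) / draw_prob t \<omega> j * second_order (r t \<omega> $ j) = R2 t j \<omega>" for t j
      by (simp add: R2_def)
    have "(\<Sum>t<T. exp3p_estimate \<gamma> (weight t \<omega>) (I t \<omega>) (r t \<omega>) k)
      \<le> ln CARD('k) / \<eta>
      + (\<Sum>t<T. \<Sum>j\<in>UNIV. ?q t j \<omega> * exp3p_estimate \<gamma> (weight t \<omega>) (I t \<omega>) (r t \<omega>) j
        + 2 * \<eta> * (of_bool (I t \<omega> = j) / draw_prob t \<omega> j * second_order (r t \<omega> $ j))
        + 4 * c * (1 + \<bar>r t \<omega> $ j\<bar> + second_order (r t \<omega> $ j)))"
      unfolding weight_def draw_prob_def \<eta>_def c_def
      by (rule exp3p_potential) (use parameters \<gamma> c c0 in \<open>auto simp: c_def\<close>)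
    then show ?thesis unfolding est R1 R2 R3_def .
  qed
  \<comment> \<open>This large bound only secures integrability; it does not enter the final
    estimate.\<close>
  have inv_p: "(\<lambda>\<omega>. 1 / ?p t j \<omega>) \<in> borel_measurable (draw_history M t r I t)"
    "\<bar>1 / ?p t j \<omega>\<bar> \<le> CARD('k) / \<gamma>" for t j \<omega>
  proof -
    show "(\<lambda>\<omega>. 1 / ?p t j \<omega>) \<in> borel_measurable (draw_history M t r I t)"
      by (intro borel_measurable_divide draw_prob_measurable) auto
    show "\<bar>1 / ?p t j \<omega>\<bar> \<le> CARD('k) / \<gamma>"
      using draw_prob_bounds(1,2)[of t \<omega> j] parameters by (simp add: field_simps)
  qed
  have q_div_p: "(\<lambda>\<omega>. ?q t j \<omega> / ?p t j \<omega>) \<in> borel_measurable (draw_history M t r I t)"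
    "\<bar>?q t j \<omega> / ?p t j \<omega>\<bar> \<le> 2" for t j \<omega>
  proof -
    show "(\<lambda>\<omega>. ?q t j \<omega> / ?p t j \<omega>) \<in> borel_measurable (draw_history M t r I t)"
      by (intro borel_measurable_divide draw_prob_measurable sample_weight_measurable) auto
    have "0 \<le> ?q t j \<omega> / ?p t j \<omega>"
      using draw_prob_bounds(2)[of t \<omega> j] sample_weight_bounds(1)[of "weight t \<omega>" j, OF weight_pos] by simp
    then show "\<bar>?q t j \<omega> / ?p t j \<omega>\<bar> \<le> 2"
      using sample_weight_le_exp3p_prob[of "weight t \<omega>" \<gamma> j, OF weight_pos] parameters \<gamma>
      by (simp add: draw_prob_def)
  qed
  have L: "integrable M (L t j)" "expectation (L t j) = ?\<mu> j" if "t < T" for t j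
    using expectation_draw_reward[OF that inv_p, of "\<lambda>x. x $ j" j j] integrable_reward_law(1)
    by (simp_all add: L_def[abs_def] p0 integral_reward_component prob_space)
  have R1: "integrable M (R1 t j)" "expectation (R1 t j) = expectation (?q t j) * ?\<mu> j" if "t < T" for t j
    using expectation_draw_reward[OF that q_div_p, of "\<lambda>x. x $ j" j j] integrable_reward_law(1)
    by (simp_all add: R1_def[abs_def] p0 integral_reward_component)
  have so [measurable]: "second_order \<in> borel_measurable borel"
    unfolding second_order_def[abs_def] by measurable
  \<comment> \<open>The coefficient \<open>1 / p\<close> cancels against the draw probability, so no
    inverse power of \<gamma> appears.\<close>
  have R2: "integrable M (R2 t j)" "expectation (R2 t j) = ?G j" if "t < T" for t j
    using expectation_draw_reward[OF that inv_p, of "\<lambda>x. second_order (x $ j)" j j] integrable_reward_law(4)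
    by (simp_all add: R2_def[abs_def] p0 prob_space)
  have R3: "integrable M (R3 t j)" "expectation (R3 t j) = 1 + ?m j + ?G j" if "t < T" for t j
    using expectation_reward[OF that, of "\<lambda>x. \<bar>x $ j\<bar>"]
      expectation_reward[OF that, of "\<lambda>x. second_order (x $ j)"] integrable_reward_law(3,4)
    by (simp_all add: R3_def[abs_def] prob_space)
  have "T * ?\<mu> k = expectation (\<lambda>\<omega>. \<Sum>t<T. L t k \<omega>)"
    by (subst Bochner_Integration.integral_sum) (auto simp: L)
  also have "\<dots> \<le> expectation (\<lambda>\<omega>. ln CARD('k) / \<eta>
      + (\<Sum>t<T. \<Sum>j\<in>UNIV. R1 t j \<omega> + 2 * \<eta> * R2 t j \<omega> + 4 * c * R3 t j \<omega>))"
    by (rule integral_mono) (auto intro!: path Bochner_Integration.integrable_sum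
        Bochner_Integration.integrable_add integrable_mult_right L R1 R2 R3)
  also have "\<dots> = ln CARD('k) / \<eta>
      + (\<Sum>t<T. \<Sum>j\<in>UNIV. expectation (?q t j) * ?\<mu> j + 2 * \<eta> * ?G j + 4 * c * (1 + ?m j + ?G j))"
  proof -
    have "expectation (\<lambda>\<omega>. R1 t j \<omega> + 2 * \<eta> * R2 t j \<omega> + 4 * c * R3 t j \<omega>)
        = expectation (?q t j) * ?\<mu> j + 2 * \<eta> * ?G j + 4 * c * (1 + ?m j + ?G j)"
      and int: "integrable M (\<lambda>\<omega>. R1 t j \<omega> + 2 * \<eta> * R2 t j \<omega> + 4 * c * R3 t j \<omega>)"
      if "t < T" for t j
      using R1[OF that] R2[OF that] R3[OF that] by simp_all
    then have "expectation (\<lambda>\<omega>. \<Sum>t<T. \<Sum>j\<in>UNIV. R1 t j \<omega> + 2 * \<eta> * R2 t j \<omega> + 4 * c * R3 t j \<omega>)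
        = (\<Sum>t<T. \<Sum>j\<in>UNIV. expectation (?q t j) * ?\<mu> j + 2 * \<eta> * ?G j + 4 * c * (1 + ?m j + ?G j))"
      by (subst Bochner_Integration.integral_sum)
        (auto intro!: sum.cong Bochner_Integration.integrable_sum simp: Bochner_Integration.integral_sum)
    moreover have "integrable M (\<lambda>\<omega>. \<Sum>t<T. \<Sum>j\<in>UNIV. R1 t j \<omega> + 2 * \<eta> * R2 t j \<omega> + 4 * c * R3 t j \<omega>)"
      by (intro Bochner_Integration.integrable_sum int) auto
    ultimately show ?thesis by (simp add: prob_space)
  qed
  also have "\<dots> \<le> ln CARD('k) / \<eta>
      + (\<Sum>t<T. \<Sum>j\<in>UNIV. expectation (?p t j) * ?\<mu> j + (\<gamma> * \<bar>?\<mu> j\<bar> + 2 * \<eta> * ?G j + 4 * c * (1 + ?m j + ?G j)))"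
  proof -
    \<comment> \<open>The price of exploration: \<open>q\<close> and \<open>p\<close> differ by at
      most \<gamma>. With \<open>p\<close> in place of \<open>q\<close>, the sum over the arms is
      the expected received reward.\<close>
    have "expectation (?q t j) * ?\<mu> j \<le> expectation (?p t j) * ?\<mu> j + \<gamma> * \<bar>?\<mu> j\<bar>" if t: "t < T" for t j
    proof -
      have "\<bar>expectation (\<lambda>\<omega>. ?q t j \<omega> - ?p t j \<omega>)\<bar> \<le> expectation (\<lambda>\<omega>. \<bar>?q t j \<omega> - ?p t j \<omega>\<bar>)"
        by (rule integral_abs_bound)
      also have "\<dots> \<le> expectation (\<lambda>\<omega>. \<gamma>)"
        using t by (intro integral_mono integrable_abs Bochner_Integration.integrable_diff
            integrable_sample_weight integrable_draw_prob draw_prob_minus_sample_weight) auto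
      finally have "\<bar>expectation (?q t j) - expectation (?p t j)\<bar> \<le> \<gamma>"
        using t by (simp add: prob_space integrable_sample_weight integrable_draw_prob)
      then have "\<bar>(expectation (?q t j) - expectation (?p t j)) * ?\<mu> j\<bar> \<le> \<gamma> * \<bar>?\<mu> j\<bar>"
        by (simp add: abs_mult mult_right_mono)
      then show ?thesis by (simp add: algebra_simps abs_le_iff)
    qed
    then show ?thesis by (intro add_left_mono sum_mono) (simp add: add_ac)
  qed
  also have "\<dots> = (\<Sum>t<T. expectation (\<lambda>\<omega>. r t \<omega> $ I t \<omega>)) + ln CARD('k) / \<eta>
    + T * (\<Sum>j\<in>UNIV. \<gamma> * \<bar>?\<mu> j\<bar> + 2 * \<eta> * ?G j + 4 * c * (1 + ?m j + ?G j))"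
    by (simp add: sum.distrib received_reward(2))
  finally show ?thesis .
qed

section \<open>The best cumulative reward and the expected regret\<close>

lemma best_arm_integrable: "integrable M (\<lambda>\<omega>. MAX j. \<Sum>t<T. r t \<omega> $ j)"
proof -
  \<comment> \<open>Generalized to nonempty sets of arms for the induction.\<close>
  have "integrable M (\<lambda>\<omega>. MAX j\<in>J. \<Sum>t<T. r t \<omega> $ j)" if "finite J" "J \<noteq> {}" for J :: "'k set"
    using that
  proof (induction rule: finite_ne_induct)
    case (singleton j)
    then show ?case by (auto intro!: Bochner_Integration.integrable_sum expectation_component)
  next
    case (insert j J)
    then have eq: "(MAX j\<in>insert j J. \<Sum>t<T. r t \<omega> $ j)
        = max (\<Sum>t<T. r t \<omega> $ j) (MAX j\<in>J. \<Sum>t<T. r t \<omega> $ j)" for \<omega>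
      by simp
    show ?case
      unfolding eq using insert
      by (intro integrable_max Bochner_Integration.integrable_sum expectation_component) auto
  qed
  then show ?thesis by simp
qed

lemma regret_expectation:
  "expectation (regret T r I)
    = expectation (\<lambda>\<omega>. MAX j. \<Sum>t<T. r t \<omega> $ j) - (\<Sum>t<T. expectation (\<lambda>\<omega>. r t \<omega> $ I t \<omega>))"
  unfolding regret_def[abs_def]
  by (subst Bochner_Integration.integral_diff)
    (auto intro!: Bochner_Integration.integrable_sum received_reward best_arm_integrable
      simp: Bochner_Integration.integral_sum received_reward(1))

lemma sum_component:
  "integrable M (\<lambda>\<omega>. \<Sum>t<T. r t \<omega> $ j)" "expectation (\<lambda>\<omega>. \<Sum>t<T. r t \<omega> $ j) = T * mean_vector f $ j"
proof -
  show "integrable M (\<lambda>\<omega>. \<Sum>t<T. r t \<omega> $ j)"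
    by (intro Bochner_Integration.integrable_sum expectation_component) auto
  show "expectation (\<lambda>\<omega>. \<Sum>t<T. r t \<omega> $ j) = T * mean_vector f $ j"
    by (subst Bochner_Integration.integral_sum) (auto simp: expectation_component)
qed

lemma best_mean:
  obtains k where "(MAX k. mean_vector f $ k) = mean_vector f $ k"
proof -
  have "(MAX k. mean_vector f $ k) \<in> range (\<lambda>k. mean_vector f $ k)" by (intro Max_in) auto
  then show thesis using that by (elim rangeE)
qed

text \<open>The best total dominates the total of the arm with the largest mean.\<close>

lemma pseudo_regret_le_regret: "pseudo_regret f M T r I \<le> expectation (regret T r I)"
proof -
  obtain k where k: "(MAX k. mean_vector f $ k) = mean_vector f $ k" by (rule best_mean)
  have "T * mean_vector f $ k \<le> expectation (\<lambda>\<omega>. MAX j. \<Sum>t<T. r t \<omega> $ j)"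
    unfolding sum_component(2)[symmetric]
    by (intro integral_mono sum_component best_arm_integrable Max_ge) auto
  then show ?thesis by (simp add: pseudo_regret_def regret_expectation k)
qed

text \<open>The centred sum has second moment \<open>T\<close> times the variance; a weighted
  arithmetic-geometric inequality turns this into a first-moment bound of order
  \<open>sqrt T\<close>.\<close>

lemma expectation_abs_deviation:
  "expectation (\<lambda>\<omega>. \<bar>(\<Sum>t<T. r t \<omega> $ j) - T * mean_vector f $ j\<bar>)
    \<le> sqrt T * (((\<integral>x. (x $ j - mean_vector f $ j)\<^sup>2 \<partial>reward_law f) + 1) / 2)"
proof (cases "T = 0")
  case False
  define X where "X t \<omega> = r t \<omega> $ j - mean_vector f $ j" for t \<omega>
  let ?V = "\<integral>x. (x $ j - mean_vector f $ j)\<^sup>2 \<partial>reward_law f"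
  have sum: "(\<Sum>t<T. X t \<omega>) = (\<Sum>t<T. r t \<omega> $ j) - T * mean_vector f $ j" for \<omega>
    by (simp add: X_def sum_subtractf)
  have "indep_vars (\<lambda>_. borel) r {..<T}" using run by (simp add: exp3p_run_def)
  then have indep: "indep_vars (\<lambda>_. borel) X {..<T}"
    unfolding X_def[abs_def]
    by (rule indep_vars_compose2[where Y = "\<lambda>_ x. x $ j - mean_vector f $ j"]) measurable
  have X2: "integrable M (\<lambda>\<omega>. (X t \<omega>)\<^sup>2)" "expectation (\<lambda>\<omega>. (X t \<omega>)\<^sup>2) = ?V" if "t < T" for t
    using expectation_reward[OF that, of "\<lambda>x. (x $ j - mean_vector f $ j)\<^sup>2"] integrable_reward_law(2)
    by (simp_all add: X_def)
  have X0: "expectation (X t) = 0" if "t < T" for t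
    using expectation_component[OF that, of j] by (simp add: X_def[abs_def] prob_space)
  have S2: "integrable M (\<lambda>\<omega>. (\<Sum>t<T. X t \<omega>)\<^sup>2)" "expectation (\<lambda>\<omega>. (\<Sum>t<T. X t \<omega>)\<^sup>2) = T * ?V"
    using expectation_indep_sum_square[OF _ indep] X2 X0 by auto
  \<comment> \<open>The weight \<open>sqrt T\<close> makes both halves of order
    \<open>sqrt T\<close> after taking expectations.\<close>
  have amgm: "\<bar>s\<bar> \<le> (s\<^sup>2 / sqrt T + sqrt T) / 2" for s :: real
  proof -
    have "0 \<le> (\<bar>s\<bar> - sqrt T)\<^sup>2" by simp
    then have "2 * \<bar>s\<bar> * sqrt T \<le> s\<^sup>2 + sqrt T * sqrt T"
      by (simp add: power2_diff)
    then show ?thesis using False by (simp add: field_simps)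
  qed
  have "integrable M (\<lambda>\<omega>. \<Sum>t<T. X t \<omega>)"
    unfolding sum using sum_component(1)[of j] by simp
  then have "expectation (\<lambda>\<omega>. \<bar>\<Sum>t<T. X t \<omega>\<bar>) \<le> expectation (\<lambda>\<omega>. ((\<Sum>t<T. X t \<omega>)\<^sup>2 / sqrt T + sqrt T) / 2)"
    using S2(1) amgm by (intro integral_mono) auto
  also have "\<dots> = (T * ?V / sqrt T + sqrt T) / 2"
    using S2 by (simp add: prob_space)
  also have "\<dots> = sqrt T * ((?V + 1) / 2)"
    using real_div_sqrt[of "real T"] by (simp add: algebra_simps flip: times_divide_eq_left)
  finally show ?thesis unfolding sum .
qed simp

text \<open>Each total is at most \<open>T\<close> times the best mean plus its own deviation. The
  sum of all deviations is uniform in the arm and so bounds the maximum.\<close>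

lemma best_arm_expectation_le:
  "expectation (\<lambda>\<omega>. MAX j. \<Sum>t<T. r t \<omega> $ j) \<le> T * (MAX k. mean_vector f $ k)
    + sqrt T * (\<Sum>j\<in>UNIV. ((\<integral>x. (x $ j - mean_vector f $ j)\<^sup>2 \<partial>reward_law f) + 1) / 2)"
proof -
  let ?D = "\<lambda>j \<omega>. \<bar>(\<Sum>t<T. r t \<omega> $ j) - T * mean_vector f $ j\<bar>"
  have int: "integrable M (?D j)" for j
    using sum_component(1)[of j] by simp
  have "(\<Sum>t<T. r t \<omega> $ j) \<le> T * (MAX k. mean_vector f $ k) + (\<Sum>j\<in>UNIV. ?D j \<omega>)" for j \<omega>
  proof -
    have "T * mean_vector f $ j \<le> T * (MAX k. mean_vector f $ k)"
      by (intro mult_left_mono Max_ge) auto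
    moreover have "?D j \<omega> \<le> (\<Sum>j\<in>UNIV. ?D j \<omega>)" by (intro member_le_sum) auto
    ultimately show ?thesis by linarith
  qed
  then have "expectation (\<lambda>\<omega>. MAX j. \<Sum>t<T. r t \<omega> $ j)
      \<le> expectation (\<lambda>\<omega>. T * (MAX k. mean_vector f $ k) + (\<Sum>j\<in>UNIV. ?D j \<omega>))"
    using int by (intro integral_mono best_arm_integrable) auto
  also have "\<dots> = T * (MAX k. mean_vector f $ k) + (\<Sum>j\<in>UNIV. expectation (?D j))"
    using int by (simp add: prob_space)
  also have "\<dots> \<le> T * (MAX k. mean_vector f $ k)
      + (\<Sum>j\<in>UNIV. sqrt T * (((\<integral>x. (x $ j - mean_vector f $ j)\<^sup>2 \<partial>reward_law f) + 1) / 2))"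
    by (intro add_left_mono sum_mono expectation_abs_deviation)
  finally show ?thesis by (simp only: sum_distrib_left)
qed

text \<open>The best total and the negated received total are both at most the sum of all absolute
  rewards. This covers the parameters excluded from \<open>exp3p_mean_bound\<close>.\<close>

lemma regret_le_linear:
  "expectation (regret T r I) \<le> T * (2 * (\<Sum>j\<in>UNIV. \<integral>x. \<bar>x $ j\<bar> \<partial>reward_law f))"
proof -
  let ?A = "\<lambda>\<omega>. \<Sum>t<T. \<Sum>j\<in>UNIV. \<bar>r t \<omega> $ j\<bar>"
  have abs: "integrable M (\<lambda>\<omega>. \<bar>r t \<omega> $ j\<bar>)"
    "expectation (\<lambda>\<omega>. \<bar>r t \<omega> $ j\<bar>) = (\<integral>x. \<bar>x $ j\<bar> \<partial>reward_law f)" if "t < T" for t j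
    using expectation_reward[OF that, of "\<lambda>x. \<bar>x $ j\<bar>"] integrable_reward_law(3)[of j] by auto
  have int: "integrable M ?A"
    by (intro Bochner_Integration.integrable_sum abs) auto
  have le: "\<bar>r t \<omega> $ j\<bar> \<le> (\<Sum>j\<in>UNIV. \<bar>r t \<omega> $ j\<bar>)" for t \<omega> j
    by (intro member_le_sum) auto
  have "(MAX j. \<Sum>t<T. r t \<omega> $ j) \<le> ?A \<omega>" for \<omega>
    using le by (auto intro!: sum_mono intro: order_trans[OF abs_ge_self])
  then have "expectation (\<lambda>\<omega>. MAX j. \<Sum>t<T. r t \<omega> $ j) \<le> expectation ?A"
    using int by (intro integral_mono best_arm_integrable) auto
  moreover have "- (\<Sum>t<T. expectation (\<lambda>\<omega>. r t \<omega> $ I t \<omega>)) \<le> expectation ?A"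
  proof -
    have "- (\<Sum>j\<in>UNIV. \<bar>r t \<omega> $ j\<bar>) \<le> r t \<omega> $ I t \<omega>" for t \<omega>
      using le[of t \<omega> "I t \<omega>"] by linarith
    then have "(\<Sum>t<T. - (\<Sum>j\<in>UNIV. \<bar>r t \<omega> $ j\<bar>)) \<le> (\<Sum>t<T. r t \<omega> $ I t \<omega>)" for \<omega>
      by (rule sum_mono)
    then have "- ?A \<omega> \<le> (\<Sum>t<T. r t \<omega> $ I t \<omega>)" for \<omega>
      by (simp add: sum_negf)
    then have "expectation (\<lambda>\<omega>. - ?A \<omega>) \<le> expectation (\<lambda>\<omega>. \<Sum>t<T. r t \<omega> $ I t \<omega>)"
      using int by (intro integral_mono Bochner_Integration.integrable_sum received_reward) auto
    then show ?thesis
      by (simp add: Bochner_Integration.integral_sum received_reward(1))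
  qed
  moreover have "expectation ?A = T * (\<Sum>j\<in>UNIV. \<integral>x. \<bar>x $ j\<bar> \<partial>reward_law f)"
    by (subst Bochner_Integration.integral_sum)
      (auto intro!: Bochner_Integration.integrable_sum simp: abs Bochner_Integration.integral_sum)
  ultimately show ?thesis unfolding regret_expectation by simp
qed

text \<open>Adds the error against the arm with the best mean and the fluctuation of the best total
  above \<open>T\<close> times that mean.\<close>

lemma regret_le_exp3p:
  defines "\<eta> \<equiv> \<gamma> / (3 * CARD('k))" and "c \<equiv> \<alpha> / sqrt (CARD('k) * T)"
  assumes "\<gamma> \<le> 1 / 2" and "c \<le> 1"
  shows "expectation (regret T r I) \<le> ln CARD('k) / \<eta>
    + T * (\<Sum>j\<in>UNIV. \<gamma> * \<bar>mean_vector f $ j\<bar> + 2 * \<eta> * (\<integral>x. second_order (x $ j) \<partial>reward_law f)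
      + 4 * c * (1 + (\<integral>x. \<bar>x $ j\<bar> \<partial>reward_law f) + (\<integral>x. second_order (x $ j) \<partial>reward_law f)))
    + sqrt T * (\<Sum>j\<in>UNIV. ((\<integral>x. (x $ j - mean_vector f $ j)\<^sup>2 \<partial>reward_law f) + 1) / 2)"
proof -
  obtain k where k: "(MAX k. mean_vector f $ k) = mean_vector f $ k" by (rule best_mean)
  show ?thesis
    using exp3p_mean_bound[OF assms(3) assms(4)[unfolded c_def], of k] best_arm_expectation_le
    unfolding regret_expectation k \<eta>_def c_def by linarith
qed

end

section \<open>The regret bound\<close>

theorem theorem10:
  fixes f :: "real^'k::finite \<Rightarrow> real" and \<delta> :: real
    and \<alpha> \<gamma> :: "nat \<Rightarrow> real"
  assumes "sub_gaussian_bandit f"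
    and "0 < \<delta>" and "\<delta> < 1"
    and "\<And>T. \<gamma> T = 2 * sqrt (3 * real CARD('k) * ln (real CARD('k)) / (5 * real T))"
    and "\<And>T. \<alpha> T = 2 * sqrt (ln (real CARD('k) * real T / \<delta>))"
  shows "\<exists>h::nat \<Rightarrow> real. bigo_star h (\<lambda>T. sqrt (real T)) \<and>
    (\<forall>T (M::'w measure) (r::nat \<Rightarrow> 'w \<Rightarrow> real^'k) (I::nat \<Rightarrow> 'w \<Rightarrow> 'k).
       exp3p_run f (\<alpha> T) (\<gamma> T) T M r I \<longrightarrow>
         pseudo_regret f M T r I \<le> (\<integral>\<omega>. regret T r I \<omega> \<partial>M) \<and>
         (\<integral>\<omega>. regret T r I \<omega> \<partial>M) \<le> h T)"
proof -
  define K where "K = real CARD('k)"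
  define a where "a = 2 * sqrt (3 * K * ln K / 5)"
  define \<mu> where "\<mu> = (\<Sum>j\<in>UNIV. \<bar>mean_vector f $ j\<bar>)"
  define G where "G = (\<Sum>j\<in>UNIV. \<integral>x. second_order (x $ j) \<partial>reward_law f)"
  define m where "m = (\<Sum>j\<in>UNIV. \<integral>x. \<bar>x $ j\<bar> \<partial>reward_law f)"
  define V where "V = (\<Sum>j\<in>UNIV. ((\<integral>x. (x $ j - mean_vector f $ j)\<^sup>2 \<partial>reward_law f) + 1) / 2)"
  define c where "c T = \<alpha> T / sqrt (K * real T)" for T
  define bound where "bound T = ln K / (\<gamma> T / (3 * K)) + T * (\<gamma> T * \<mu> + 2 * (\<gamma> T / (3 * K)) * G
    + 4 * c T * (K + m + G)) + sqrt T * V" for T :: nat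
  \<comment> \<open>\<open>h\<close> involves only \<delta>, the number of arms and moments of
    \<open>f\<close>, so it is the same for all probability spaces and runs. The linear branch is
    used for finitely many \<open>T\<close> only.\<close>
  define h where "h T = (if \<gamma> T \<le> 1 / 2 \<and> c T \<le> 1 then bound T else T * (2 * m))" for T :: nat
  have K: "1 \<le> K" by (simp add: K_def Suc_le_eq)
  have \<gamma>: "\<gamma> T = a / sqrt T" for T
    by (simp add: assms(4) a_def K_def real_sqrt_divide real_sqrt_mult)
  have \<alpha>: "\<alpha> = (\<lambda>T. 2 * sqrt (ln (K * real T / \<delta>)))"
    by (simp add: fun_eq_iff assms(5) K_def)
  have "bigo_star h (\<lambda>T. sqrt (real T))"
  proof -
    have "(\<lambda>T::nat. a / sqrt T) \<longlonglongrightarrow> 0" by real_asymp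
    then have "(\<lambda>T. \<gamma> T) \<longlonglongrightarrow> 0" by (simp add: \<gamma>)
    then have "eventually (\<lambda>T. \<gamma> T < 1 / 2) sequentially" by (rule order_tendstoD) simp
    moreover have "(\<lambda>T::nat. 2 * sqrt (ln (K * real T / \<delta>)) / sqrt (K * real T)) \<longlonglongrightarrow> 0"
      using K assms(2) by real_asymp
    then have "c \<longlonglongrightarrow> 0" unfolding c_def \<alpha> .
    then have "eventually (\<lambda>T. c T < 1) sequentially" by (rule order_tendstoD) simp
    moreover have "eventually (\<lambda>T::nat. 0 < T) sequentially" by (rule eventually_gt_at_top)
    \<comment> \<open>Eventually only the first branch counts. All its terms are of order
      \<open>sqrt T\<close>, except the one from the confidence bonus, of order
      \<open>\<alpha> T * sqrt T\<close>.\<close>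
    ultimately have ev: "eventually (\<lambda>T. h T = (3 * K * ln K / a + a * (\<mu> + 2 * G / (3 * K)) + V) * sqrt T
        + (4 * (K + m + G) / sqrt K) * (\<alpha> T * sqrt T)) sequentially"
    proof eventually_elim
      case (elim T)
      define s where "s = sqrt (real T)"
      have s: "0 < s" "real T = s * s" using elim by (auto simp: s_def)
      have "h T = ln K / (a / s / (3 * K)) + s * s * (a / s * \<mu> + 2 * (a / s / (3 * K)) * G
          + 4 * (\<alpha> T / (sqrt K * s)) * (K + m + G)) + s * V"
        using elim by (simp add: h_def bound_def \<gamma> c_def real_sqrt_mult flip: s_def s(2))
      also have "\<dots> = (3 * K * ln K / a + a * (\<mu> + 2 * G / (3 * K)) + V) * s
          + (4 * (K + m + G) / sqrt K) * (\<alpha> T * s)"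
      proof -
        \<comment> \<open>For \<open>K = 1\<close> both \<open>a\<close> and \<open>ln K\<close>
          vanish, and the identity holds since division by 0 gives 0.\<close>
        have "ln K / (a / s / (3 * K)) = 3 * K * ln K / a * s" using K by simp
        moreover have "s * s * (a / s * \<mu> + 2 * (a / s / (3 * K)) * G + 4 * (\<alpha> T / (sqrt K * s)) * (K + m + G))
            = s * (a * \<mu> + 2 * (a / (3 * K)) * G + 4 * (\<alpha> T / sqrt K) * (K + m + G))"
          using s(1) K by (simp add: field_simps)
        ultimately show ?thesis by (simp add: algebra_simps)
      qed
      finally show ?case by (simp add: s_def)
    qed
    have "(\<lambda>T::nat. sqrt T) \<in> O(\<lambda>T. sqrt (real T) * ln (sqrt (real T)))"
      by real_asymp
    \<comment> \<open>\<open>\<alpha> T\<close> grows like the square root of \<open>ln T\<close>,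
      so one logarithm absorbs it; hence the exponent 1 chosen for \<open>bigo_star\<close>.\<close>
    moreover have "(\<lambda>T. \<alpha> T * sqrt (real T)) \<in> O(\<lambda>T. sqrt (real T) * ln (sqrt (real T)))"
      unfolding \<alpha> using K assms(2) by real_asymp
    moreover have cmult: "(\<lambda>T. C * u T) \<in> O(v)" if "u \<in> O(v)" for C :: real and u v :: "nat \<Rightarrow> real"
      using that by (cases "C = 0") auto
    ultimately have "(\<lambda>T. (3 * K * ln K / a + a * (\<mu> + 2 * G / (3 * K)) + V) * sqrt T
        + (4 * (K + m + G) / sqrt K) * (\<alpha> T * sqrt T)) \<in> O(\<lambda>T. sqrt (real T) * ln (sqrt (real T)))"
      by (intro sum_in_bigo cmult)
    then have "h \<in> O(\<lambda>T. sqrt (real T) * ln (sqrt (real T)))"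
      using landau_o.big.in_cong[OF ev] by blast
    then show ?thesis
      unfolding bigo_star_def by (intro exI[of _ 1]) simp
  qed
  moreover have "pseudo_regret f M T r I \<le> (\<integral>\<omega>. regret T r I \<omega> \<partial>M) \<and> (\<integral>\<omega>. regret T r I \<omega> \<partial>M) \<le> h T"
    if run: "exp3p_run f (\<alpha> T) (\<gamma> T) T M r I"
    for T and M :: "'w measure" and r :: "nat \<Rightarrow> 'w \<Rightarrow> real^'k" and I :: "nat \<Rightarrow> 'w \<Rightarrow> 'k"
  proof -
    interpret exp3p_bandit f "\<alpha> T" "\<gamma> T" T M r I
      using assms(1) run by unfold_locales
    have "expectation (regret T r I) \<le> bound T" if "\<gamma> T \<le> 1 / 2" "c T \<le> 1"
    proof -
      \<comment> \<open>Summing over the arms turns the constant 1 into \<open>K\<close> and the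
        moments into \<open>\<mu>\<close>, \<open>G\<close> and \<open>m\<close>.\<close>
      have "(\<Sum>j\<in>UNIV. \<gamma> T * \<bar>mean_vector f $ j\<bar> + 2 * (\<gamma> T / (3 * K)) * (\<integral>x. second_order (x $ j) \<partial>reward_law f)
          + 4 * c T * (1 + (\<integral>x. \<bar>x $ j\<bar> \<partial>reward_law f) + (\<integral>x. second_order (x $ j) \<partial>reward_law f)))
          = \<gamma> T * \<mu> + 2 * (\<gamma> T / (3 * K)) * G + 4 * c T * (K + m + G)"
        unfolding \<mu>_def G_def m_def by (simp only: sum.distrib flip: sum_distrib_left) (simp add: K_def)
      then show ?thesis
        using regret_le_exp3p that by (simp add: bound_def c_def V_def K_def)
    qed
    moreover have "expectation (regret T r I) \<le> T * (2 * m)"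
      unfolding m_def by (rule regret_le_linear)
    ultimately show ?thesis
      using pseudo_regret_le_regret by (simp add: h_def)
  qed
  ultimately show ?thesis by blast
qed

end
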